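(* Let $\alpha,\beta,\gamma,\delta\in\mathbb{R}$ with $\alpha+\delta\neq0$ and $\alpha\gamma-\beta\delta=0$, and let $(G_6,g,J)$ be the connected three-dimensional non-unimodular Lie group with left-invariant Lorentzian metric $g$ whose Lie algebra has a pseudo-orthonormal basis $\{e_1,e_2,e_3\}$, $e_3$ timelike, with $$[e_1,e_2]=\alpha e_2+\beta e_3,\quad [e_1,e_3]=\gamma e_2+\delta e_3,\quad [e_2,e_3]=0,$$ and with the product structure $J$ given by $Je_1=e_1$, $Je_2=e_2$, $Je_3=-e_3$. Then $(G_6,g,J)$ admits left-invariant Ricci collineations associated to the Kobayashi-Nomizu connection $\nabla^1$ if and only if one of the following holds, and in each case the space $\mathbb{V}_{\mathbb{RC}}$ of these collineations is as indicated: (1) $\alpha=\beta=0$, $\delta\neq0$, with $\mathbb{V}_{\mathbb{RC}}=\langle e_1,e_2,e_3\rangle$; (2) $\alpha\neq0$, with $\mathbb{V}_{\mathbb{RC}}=\langle -\frac{\gamma}{\alpha}e_2+e_3\rangle$ (in particular $\lambda_2=-\frac{\gamma}{\alpha}\lambda_3$).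
   Context: Pseudo-orthonormal with $e_3$ timelike means $g(e_1,e_1)=g(e_2,e_2)=1$, $g(e_3,e_3)=-1$, $g(e_i,e_j)=0$ for $i\ne j$. $J$ is extended left-invariantly to a $(1,1)$-tensor with $J^2=\mathrm{id}$. Let $\nabla$ be the Levi-Civita connection of $g$. The canonical connection is $\nabla^0_XY=\nabla_XY-\frac12(\nabla_XJ)JY$, and the Kobayashi-Nomizu connection is $$\nabla^1_XY=\nabla^0_XY-\tfrac14\big[(\nabla_YJ)JX-(\nabla_{JY}J)X\big],$$ with curvature $R^1(X,Y)Z=\nabla^1_X\nabla^1_YZ-\nabla^1_Y\nabla^1_XZ-\nabla^1_{[X,Y]}Z$. Its Ricci tensor is $$\mathrm{Ric}^1(X,Y)=-g(R^1(X,e_1)Y,e_1)-g(R^1(X,e_2)Y,e_2)+g(R^1(X,e_3)Y,e_3),$$ and its symmetrization is $\widetilde{\mathrm{Ric}}^1(X,Y)=\frac12\big(\mathrm{Ric}^1(X,Y)+\mathrm{Ric}^1(Y,X)\big)$. For a left-invariant vector field $\xi=\lambda_1e_1+\lambda_2e_2+\lambda_3e_3$ ($\lambda_i\in\mathbb{R}$), $$(L_\xi\widetilde{\mathrm{Ric}}^1)(X,Y)=\xi\big(\widetilde{\mathrm{Ric}}^1(X,Y)\big)-\widetilde{\mathrm{Ric}}^1([\xi,X],Y)-\widetilde{\mathrm{Ric}}^1(X,[\xi,Y]).$$ A left-invariant Ricci collineation associated to $\nabla^1$ is a left-invariant $\xi$ with $L_\xi\widetilde{\mathrm{Ric}}^1=0$;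 $\mathbb{V}_{\mathbb{RC}}$ denotes the real vector space of all of them, and $\langle\cdot\rangle$ denotes linear span. The group admits left-invariant Ricci collineations if there is a nonzero such $\xi$. *)

theory Defs
  imports "HOL-Analysis.Analysis" "HOL-Library.Function_Algebras"
begin

text \<open>Pointwise real vector space structure on functions; addition comes from
  \<^theory>\<open>HOL-Library.Function_Algebras\<close>.\<close>

instantiation "fun" :: (type, real_vector) real_vector
begin

definition scaleR_fun :: "real \<Rightarrow> ('a \<Rightarrow> 'b) \<Rightarrow> 'a \<Rightarrow> 'b"
  where "scaleR_fun c f = (\<lambda>x. c *\<^sub>R f x)"

instance
  by standard (auto simp: scaleR_fun_def fun_eq_iff algebra_simps)

end


section \<open>Smooth manifolds and Lie groups\<close>

text \<open>These two notions are meant for open sets only.\<close>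

primrec Ck_on :: "nat \<Rightarrow> 'b::euclidean_space set \<Rightarrow> ('b \<Rightarrow> 'c::real_normed_vector) \<Rightarrow> bool"
  where
    "Ck_on 0 S f \<longleftrightarrow> continuous_on S f"
  | "Ck_on (Suc k) S f \<longleftrightarrow> (\<forall>x\<in>S. f differentiable (at x)) \<and>
       (\<forall>v. Ck_on k S (\<lambda>x. frechet_derivative f (at x) v))"

definition smooth_on :: "'b::euclidean_space set \<Rightarrow> ('b \<Rightarrow> 'c::real_normed_vector) \<Rightarrow> bool"
  where "smooth_on S f \<longleftrightarrow> (\<forall>k. Ck_on k S f)"

text \<open>A chart is a pair of its domain and its coordinate map; the values of the coordinate
  map outside the domain are irrelevant. Atlases need not be maximal.\<close>

type_synonym ('a, 'e) chart = "'a set \<times> ('a \<Rightarrow> 'e)"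

definition smooth_atlas ::
  "('a::{t2_space,second_countable_topology}, 'e::euclidean_space) chart set \<Rightarrow> bool"
  where "smooth_atlas A \<longleftrightarrow>
    (\<Union>(U, \<phi>)\<in>A. U) = UNIV \<and>
    (\<forall>(U, \<phi>)\<in>A. open U \<and> open (\<phi> ` U) \<and> homeomorphism U (\<phi> ` U) \<phi> (inv_into U \<phi>)) \<and>
    (\<forall>(U, \<phi>)\<in>A. \<forall>(V, \<psi>)\<in>A. smooth_on (\<phi> ` (U \<inter> V)) (\<psi> \<circ> inv_into U \<phi>))"

definition smooth_map ::
  "('a::topological_space, 'e::euclidean_space) chart set \<Rightarrow>
   ('b::topological_space, 'f::euclidean_space) chart set \<Rightarrow> ('a \<Rightarrow> 'b) \<Rightarrow> bool"
  where "smooth_map A B F \<longleftrightarrow> continuous_on UNIV F \<and>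
    (\<forall>(U, \<phi>)\<in>A. \<forall>(V, \<psi>)\<in>B. smooth_on (\<phi> ` (U \<inter> F -` V)) (\<psi> \<circ> F \<circ> inv_into U \<phi>))"

definition prod_atlas ::
  "('a, 'e) chart set \<Rightarrow> ('b, 'f) chart set \<Rightarrow> ('a \<times> 'b, 'e \<times> 'f) chart set"
  where "prod_atlas A B = (\<lambda>((U, \<phi>), (V, \<psi>)). (U \<times> V, map_prod \<phi> \<psi>)) ` (A \<times> B)"

definition lie_group ::
  "('a::{t2_space,second_countable_topology}, 'e::euclidean_space) chart set \<Rightarrow>
   ('a \<Rightarrow> 'a \<Rightarrow> 'a) \<Rightarrow> 'a \<Rightarrow> ('a \<Rightarrow> 'a) \<Rightarrow> bool"
  where "lie_group A mul idt iv \<longleftrightarrow> smooth_atlas A \<and> group mul idt iv \<and>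
    smooth_map (prod_atlas A A) A (\<lambda>(x, y). mul x y) \<and> smooth_map A A iv"


section \<open>Smooth functions and vector fields\<close>

definition smooth_fun :: "('a, 'e::euclidean_space) chart set \<Rightarrow> ('a \<Rightarrow> real) \<Rightarrow> bool"
  where "smooth_fun A f \<longleftrightarrow> (\<forall>(U, \<phi>)\<in>A. smooth_on (\<phi> ` U) (f \<circ> inv_into U \<phi>))"

text \<open>A vector field is represented by the operator \<open>f \<mapsto> X f\<close> on smooth functions, given in each
  chart by \<open>X f = \<Sum>i. w\<^sub>i \<partial>\<^sub>i f\<close> with smooth coefficients \<open>w\<close>. On functions that are not smooth the
  operator is fixed to be 0, so that equality of vector fields is equality of operators.\<close>

type_synonym 'a vfield = "('a \<Rightarrow> real) \<Rightarrow> 'a \<Rightarrow> real"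

definition vector_fields :: "('a, 'e::euclidean_space) chart set \<Rightarrow> 'a vfield set"
  where "vector_fields A = {X.
    (\<forall>f. \<not> smooth_fun A f \<longrightarrow> X f = 0) \<and>
    (\<forall>(U, \<phi>)\<in>A. \<exists>w::'e \<Rightarrow> 'e. smooth_on (\<phi> ` U) w \<and>
       (\<forall>f. smooth_fun A f \<longrightarrow>
         (\<forall>p\<in>U. X f p = frechet_derivative (f \<circ> inv_into U \<phi>) (at (\<phi> p)) (w (\<phi> p)))))}"

definition fmult :: "('a \<Rightarrow> real) \<Rightarrow> 'a vfield \<Rightarrow> 'a vfield"
  where "fmult h X = (\<lambda>f. h * X f)"

definition lie_bracket :: "'a vfield \<Rightarrow> 'a vfield \<Rightarrow> 'a vfield"
  where "lie_bracket X Y = (\<lambda>f. X (Y f) - Y (X f))"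

text \<open>Push-forward along left translation by \<open>a\<close>.\<close>

definition push_left ::
  "('a \<Rightarrow> 'a \<Rightarrow> 'a) \<Rightarrow> ('a \<Rightarrow> 'a) \<Rightarrow> 'a \<Rightarrow> 'a vfield \<Rightarrow> 'a vfield"
  where "push_left mul iv a X = (\<lambda>f p. X (\<lambda>q. f (mul a q)) (mul (iv a) p))"

definition left_inv_fields ::
  "('a, 'e::euclidean_space) chart set \<Rightarrow> ('a \<Rightarrow> 'a \<Rightarrow> 'a) \<Rightarrow> ('a \<Rightarrow> 'a) \<Rightarrow> 'a vfield set"
  where "left_inv_fields A mul iv = {X \<in> vector_fields A. \<forall>a. push_left mul iv a X = X}"


section \<open>Metrics, product structures and connections\<close>

text \<open>Tensor fields are represented by function-linear maps on vector fields; their values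
  on other operators are irrelevant.\<close>

definition sym_tensor2 ::
  "('a, 'e::euclidean_space) chart set \<Rightarrow> ('a vfield \<Rightarrow> 'a vfield \<Rightarrow> 'a \<Rightarrow> real) \<Rightarrow> bool"
  where "sym_tensor2 A g \<longleftrightarrow>
    (\<forall>X\<in>vector_fields A. \<forall>Y\<in>vector_fields A. smooth_fun A (g X Y) \<and> g X Y = g Y X) \<and>
    (\<forall>X\<in>vector_fields A. \<forall>Y\<in>vector_fields A. \<forall>Z\<in>vector_fields A. g (X + Y) Z = g X Z + g Y Z) \<and>
    (\<forall>f. smooth_fun A f \<longrightarrow>
       (\<forall>X\<in>vector_fields A. \<forall>Y\<in>vector_fields A. g (fmult f X) Y = f * g X Y))"

text \<open>Signature \<open>(+,+,-)\<close> at every point of a 3-manifold: each tangent space has a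
  pseudo-orthonormal basis.\<close>

definition lorentz_metric3 ::
  "('a, real^3) chart set \<Rightarrow> ('a vfield \<Rightarrow> 'a vfield \<Rightarrow> 'a \<Rightarrow> real) \<Rightarrow> bool"
  where "lorentz_metric3 A g \<longleftrightarrow> sym_tensor2 A g \<and>
    (\<forall>p. \<exists>X\<in>vector_fields A. \<exists>Y\<in>vector_fields A. \<exists>Z\<in>vector_fields A.
       g X X p = 1 \<and> g Y Y p = 1 \<and> g Z Z p = -1 \<and> g X Y p = 0 \<and> g X Z p = 0 \<and> g Y Z p = 0)"

definition left_inv_metric ::
  "('a, 'e::euclidean_space) chart set \<Rightarrow> ('a \<Rightarrow> 'a \<Rightarrow> 'a) \<Rightarrow> ('a \<Rightarrow> 'a) \<Rightarrow>
   ('a vfield \<Rightarrow> 'a vfield \<Rightarrow> 'a \<Rightarrow> real) \<Rightarrow> bool"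
  where "left_inv_metric A mul iv g \<longleftrightarrow>
    (\<forall>a p. \<forall>X\<in>vector_fields A. \<forall>Y\<in>vector_fields A.
       g (push_left mul iv a X) (push_left mul iv a Y) (mul a p) = g X Y p)"

definition tensor11 ::
  "('a, 'e::euclidean_space) chart set \<Rightarrow> ('a vfield \<Rightarrow> 'a vfield) \<Rightarrow> bool"
  where "tensor11 A J \<longleftrightarrow>
    (\<forall>X\<in>vector_fields A. J X \<in> vector_fields A) \<and>
    (\<forall>X\<in>vector_fields A. \<forall>Y\<in>vector_fields A. J (X + Y) = J X + J Y) \<and>
    (\<forall>f. smooth_fun A f \<longrightarrow> (\<forall>X\<in>vector_fields A. J (fmult f X) = fmult f (J X)))"

definition left_inv_product_structure ::
  "('a, 'e::euclidean_space) chart set \<Rightarrow> ('a \<Rightarrow> 'a \<Rightarrow> 'a) \<Rightarrow> ('a \<Rightarrow> 'a) \<Rightarrow>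
   ('a vfield \<Rightarrow> 'a vfield) \<Rightarrow> bool"
  where "left_inv_product_structure A mul iv J \<longleftrightarrow> tensor11 A J \<and>
    (\<forall>X\<in>vector_fields A. J (J X) = X) \<and>
    (\<forall>a. \<forall>X\<in>vector_fields A. J (push_left mul iv a X) = push_left mul iv a (J X))"

type_synonym 'a conn = "'a vfield \<Rightarrow> 'a vfield \<Rightarrow> 'a vfield"

definition affine_connection ::
  "('a, 'e::euclidean_space) chart set \<Rightarrow> 'a conn \<Rightarrow> bool"
  where "affine_connection A D \<longleftrightarrow>
    (\<forall>X\<in>vector_fields A. \<forall>Y\<in>vector_fields A. D X Y \<in> vector_fields A) \<and>
    (\<forall>X\<in>vector_fields A. \<forall>Y\<in>vector_fields A. \<forall>Z\<in>vector_fields A.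
       D (X + Y) Z = D X Z + D Y Z \<and> D X (Y + Z) = D X Y + D X Z) \<and>
    (\<forall>f. smooth_fun A f \<longrightarrow> (\<forall>X\<in>vector_fields A. \<forall>Y\<in>vector_fields A.
       D (fmult f X) Y = fmult f (D X Y) \<and>
       D X (fmult f Y) = fmult (X f) Y + fmult f (D X Y)))"

definition levi_civita ::
  "('a, 'e::euclidean_space) chart set \<Rightarrow> ('a vfield \<Rightarrow> 'a vfield \<Rightarrow> 'a \<Rightarrow> real) \<Rightarrow>
   'a conn \<Rightarrow> bool"
  where "levi_civita A g D \<longleftrightarrow> affine_connection A D \<and>
    (\<forall>X\<in>vector_fields A. \<forall>Y\<in>vector_fields A. D X Y - D Y X = lie_bracket X Y) \<and>
    (\<forall>X\<in>vector_fields A. \<forall>Y\<in>vector_fields A. \<forall>Z\<in>vector_fields A.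
       X (g Y Z) = g (D X Y) Z + g Y (D X Z))"

text \<open>\<open>cov_deriv11 D J X Y\<close> is \<open>(\<nabla>\<^sub>X J) Y\<close>.\<close>

definition cov_deriv11 :: "'a conn \<Rightarrow> ('a vfield \<Rightarrow> 'a vfield) \<Rightarrow> 'a conn"
  where "cov_deriv11 D J X Y = D X (J Y) - J (D X Y)"

definition canonical_connection :: "'a conn \<Rightarrow> ('a vfield \<Rightarrow> 'a vfield) \<Rightarrow> 'a conn"
  where "canonical_connection D J X Y = D X Y - (1/2) *\<^sub>R cov_deriv11 D J X (J Y)"

definition kobayashi_nomizu_connection :: "'a conn \<Rightarrow> ('a vfield \<Rightarrow> 'a vfield) \<Rightarrow> 'a conn"
  where "kobayashi_nomizu_connection D J X Y = canonical_connection D J X Y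
    - (1/4) *\<^sub>R (cov_deriv11 D J Y (J X) - cov_deriv11 D J (J Y) X)"

definition curvature :: "'a conn \<Rightarrow> 'a vfield \<Rightarrow> 'a vfield \<Rightarrow> 'a vfield \<Rightarrow> 'a vfield"
  where "curvature D X Y Z = D X (D Y Z) - D Y (D X Z) - D (lie_bracket X Y) Z"

text \<open>Ricci tensor with respect to a pseudo-orthonormal frame with \<open>e\<^sub>3\<close> timelike.\<close>

definition ricci ::
  "('a vfield \<Rightarrow> 'a vfield \<Rightarrow> 'a \<Rightarrow> real) \<Rightarrow> 'a conn \<Rightarrow> 'a vfield \<Rightarrow> 'a vfield \<Rightarrow> 'a vfield \<Rightarrow>
   'a vfield \<Rightarrow> 'a vfield \<Rightarrow> 'a \<Rightarrow> real"
  where "ricci g D e1 e2 e3 X Y =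
    - g (curvature D X e1 Y) e1 - g (curvature D X e2 Y) e2 + g (curvature D X e3 Y) e3"

definition symmetrize ::
  "('a vfield \<Rightarrow> 'a vfield \<Rightarrow> 'a \<Rightarrow> real) \<Rightarrow> 'a vfield \<Rightarrow> 'a vfield \<Rightarrow> 'a \<Rightarrow> real"
  where "symmetrize T X Y = (1/2) *\<^sub>R (T X Y + T Y X)"

definition lie_derivative2 ::
  "'a vfield \<Rightarrow> ('a vfield \<Rightarrow> 'a vfield \<Rightarrow> 'a \<Rightarrow> real) \<Rightarrow> 'a vfield \<Rightarrow> 'a vfield \<Rightarrow> 'a \<Rightarrow> real"
  where "lie_derivative2 \<xi> T X Y =
    \<xi> (T X Y) - T (lie_bracket \<xi> X) Y - T X (lie_bracket \<xi> Y)"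

definition left_inv_collineations ::
  "('a, 'e::euclidean_space) chart set \<Rightarrow> ('a \<Rightarrow> 'a \<Rightarrow> 'a) \<Rightarrow> ('a \<Rightarrow> 'a) \<Rightarrow>
   ('a vfield \<Rightarrow> 'a vfield \<Rightarrow> 'a \<Rightarrow> real) \<Rightarrow> 'a vfield set"
  where "left_inv_collineations A mul iv T =
    {\<xi> \<in> left_inv_fields A mul iv.
       \<forall>X\<in>vector_fields A. \<forall>Y\<in>vector_fields A. lie_derivative2 \<xi> T X Y = 0}"

text \<open>The space of left-invariant Ricci collineations associated to the Kobayashi-Nomizu
  connection; \<open>D\<close> is the Levi-Civita connection of \<open>g\<close>.\<close>

definition ricci_collineations_KN ::
  "('a, 'e::euclidean_space) chart set \<Rightarrow> ('a \<Rightarrow> 'a \<Rightarrow> 'a) \<Rightarrow> ('a \<Rightarrow> 'a) \<Rightarrow>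
   ('a vfield \<Rightarrow> 'a vfield \<Rightarrow> 'a \<Rightarrow> real) \<Rightarrow> ('a vfield \<Rightarrow> 'a vfield) \<Rightarrow> 'a conn \<Rightarrow>
   'a vfield \<Rightarrow> 'a vfield \<Rightarrow> 'a vfield \<Rightarrow> 'a vfield set"
  where "ricci_collineations_KN A mul iv g J D e1 e2 e3 =
    left_inv_collineations A mul iv
      (symmetrize (ricci g (kobayashi_nomizu_connection D J) e1 e2 e3))"

end

theory Submission
  imports Defs
begin

text \<open>
  A left-invariant field vanishing at one point is zero, so the independent fields \<open>e\<^sub>1, e\<^sub>2, e\<^sub>3\<close>
  form a global frame: by Cramer's rule in charts, every vector field is a combination of them with
  smooth coefficients. Hence every tensorial expression is determined by its values on the frame,
  and this applies to the Lie derivative of the symmetrized Ricci tensor of \<open>\<nabla>\<^sup>1\<close>. Koszul's formula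
  gives \<open>\<nabla>\<close>, then \<open>\<nabla>\<^sup>1\<close>, and in the frame
  \<open>Ric\<^sup>1 = diag (- (\<alpha>\<^sup>2 + \<beta> \<gamma>), - \<alpha>\<^sup>2, 0)\<close>. For \<open>\<xi> = \<lambda>\<^sub>1 e\<^sub>1 + \<lambda>\<^sub>2 e\<^sub>2 + \<lambda>\<^sub>3 e\<^sub>3\<close> the
  equations \<open>L\<^sub>\<xi> Ric\<^sup>1 = 0\<close> reduce to \<open>\<alpha>\<^sup>2 (\<alpha> \<lambda>\<^sub>2 + \<gamma> \<lambda>\<^sub>3) = 0\<close>, \<open>\<alpha>\<^sup>3 \<lambda>\<^sub>1 = 0\<close> and
  \<open>\<alpha>\<^sup>2 \<gamma> \<lambda>\<^sub>1 = 0\<close>.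
\<close>

section \<open>Smooth maps\<close>

text \<open>A derivative at a point of an open set depends only on nearby values, so all directional
  derivatives agree on \<open>S\<close> as well and the induction passes to them.\<close>

lemma Ck_on_cong:
  assumes "open S" "\<And>x. x \<in> S \<Longrightarrow> f x = g x" "Ck_on k S f"
  shows "Ck_on k S g"
  using assms(2,3)
proof (induction k arbitrary: f g)
  case 0
  then show ?case by (simp cong: continuous_on_cong)
next
  case (Suc k)
  have D: "(g has_derivative frechet_derivative f (at x)) (at x)" if "x \<in> S" for x
  proof -
    have "(f has_derivative frechet_derivative f (at x)) (at x)"
      using Suc.prems(2) that by (simp add: frechet_derivative_works[symmetric])
    then show ?thesis
      using Suc.prems(1) assms(1) that has_derivative_transform_within_open by blast
  qed
  then have eq: "frechet_derivative g (at x) = frechet_derivative f (at x)" if "x \<in> S" for x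
    using D[OF that] frechet_derivative_at by force
  show ?case
    unfolding Ck_on.simps
  proof (intro conjI ballI allI)
    show "g differentiable (at x)" if "x \<in> S" for x
      using D[OF that] by (auto simp: differentiable_def)
    show "Ck_on k S (\<lambda>x. frechet_derivative g (at x) v)" for v
      by (rule Suc.IH[of "\<lambda>x. frechet_derivative f (at x) v"]) (use Suc.prems(2) eq in auto)
  qed
qed

text \<open>By uniqueness of the derivative, an explicit formula \<open>f'\<close> may replace
  \<open>frechet_derivative\<close>. The closure rules below can therefore work with the usual
  differentiation formulas.\<close>

lemma Ck_on_SucI:
  assumes "open S" "\<And>x. x \<in> S \<Longrightarrow> (f has_derivative f' x) (at x)"
    and "\<And>v. Ck_on k S (\<lambda>x. f' x v)"
  shows "Ck_on (Suc k) S f"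
proof -
  have eq: "frechet_derivative f (at x) = f' x" if "x \<in> S" for x
    using assms(2)[OF that] frechet_derivative_at by force
  show ?thesis
    using assms(2) Ck_on_cong[OF assms(1) _ assms(3)] by (auto simp: differentiable_def eq)
qed

lemma Ck_on_mono: "Ck_on (Suc k) S f \<Longrightarrow> Ck_on k S f"
proof (induction k arbitrary: f)
  case 0
  then show ?case
    by (auto intro!: continuous_at_imp_continuous_on differentiable_imp_continuous_within)
next
  case (Suc k)
  show ?case
    using Suc.prems Suc.IH unfolding Ck_on.simps(2)[of "Suc k"] Ck_on.simps(2)[of k S f] by blast
qed

lemma Ck_on_const: "Ck_on k S (\<lambda>x. c)"
  by (induction k arbitrary: c) auto

lemma Ck_on_has_derivative:
  "Ck_on (Suc k) S f \<Longrightarrow> x \<in> S \<Longrightarrow> (f has_derivative frechet_derivative f (at x)) (at x)"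
  by (simp add: frechet_derivative_works[symmetric])

lemma Ck_on_add:
  assumes "open S" "Ck_on k S f" "Ck_on k S g"
  shows "Ck_on k S (\<lambda>x. f x + g x)"
  using assms(2,3)
proof (induction k arbitrary: f g)
  case 0
  then show ?case by (simp add: continuous_on_add)
next
  case (Suc k)
  show ?case
    by (rule Ck_on_SucI[OF assms(1)
          has_derivative_add[OF Suc.prems[THEN Ck_on_has_derivative]] Suc.IH])
      (use Suc.prems in auto)
qed

text \<open>The Leibniz rule expresses the derivative by products of the same kind, so one induction
  serves multiplication, scaling, inner product and cross product alike.\<close>

lemma (in bounded_bilinear) Ck_on:
  fixes f :: "'e::euclidean_space \<Rightarrow> 'a" and g :: "'e \<Rightarrow> 'b"
  assumes "open S" "Ck_on k S f" "Ck_on k S g"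
  shows "Ck_on k S (\<lambda>x. prod (f x) (g x))"
  using assms(2,3)
proof (induction k arbitrary: f g)
  case 0
  then show ?case by (simp add: continuous_on)
next
  case (Suc k)
  show ?case
  proof (rule Ck_on_SucI[OF assms(1)])
    show "((\<lambda>x. prod (f x) (g x)) has_derivative
        (\<lambda>h. prod (f x) (frechet_derivative g (at x) h)
          + prod (frechet_derivative f (at x) h) (g x))) (at x)" if "x \<in> S" for x
      by (rule FDERIV) (use Suc.prems that in \<open>auto intro: Ck_on_has_derivative\<close>)
    fix v
    \<comment> \<open>The differentiated factors have lost one order; the other factors are lowered
      by \<open>Ck_on_mono\<close> to the order of the induction hypothesis.\<close>
    show "Ck_on k S (\<lambda>x. prod (f x) (frechet_derivative g (at x) v)
        + prod (frechet_derivative f (at x) v) (g x))"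
      using Suc.prems Suc.prems[THEN Ck_on_mono] by (intro Ck_on_add[OF assms(1)] Suc.IH) simp_all
  qed
qed

text \<open>The derivative of \<open>1/f\<close> is \<open>-f'/f^2\<close>, in which
  \<open>1/f\<close> occurs again; the induction hypothesis covers it one order lower.\<close>

lemma Ck_on_inverse:
  fixes f :: "'e::euclidean_space \<Rightarrow> real"
  assumes "open S" "\<And>x. x \<in> S \<Longrightarrow> f x \<noteq> 0" "Ck_on k S f"
  shows "Ck_on k S (\<lambda>x. inverse (f x))"
  using assms(3)
proof (induction k)
  case 0
  then show ?case using assms(2) by (simp add: continuous_on_inverse)
next
  case (Suc k)
  show ?case
  proof (rule Ck_on_SucI[OF assms(1)])
    \<comment> \<open>The sign is written as a factor \<open>- 1\<close>, so that the rule for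
      bilinear products applies to the whole expression.\<close>
    show "((\<lambda>x. inverse (f x)) has_derivative
        (\<lambda>h. - 1 * (inverse (f x) * frechet_derivative f (at x) h * inverse (f x)))) (at x)" if "x \<in> S" for x
      using Deriv.has_derivative_inverse[OF assms(2)[OF that] Ck_on_has_derivative[OF Suc.prems that]] by simp
    show "Ck_on k S (\<lambda>x. - 1 * (inverse (f x) * frechet_derivative f (at x) v * inverse (f x)))" for v
      using Suc.prems
      by (intro bounded_bilinear.Ck_on[OF bounded_bilinear_mult assms(1)] Ck_on_const Suc.IH
          Ck_on_mono[OF Suc.prems]) auto
  qed
qed

section \<open>Closure properties of smooth maps\<close>

lemma smooth_on_cong:
  "open S \<Longrightarrow> smooth_on S f \<Longrightarrow> (\<And>x. x \<in> S \<Longrightarrow> f x = g x) \<Longrightarrow> smooth_on S g"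
  unfolding smooth_on_def using Ck_on_cong by metis

lemma smooth_on_const: "smooth_on S (\<lambda>x. c)"
  unfolding smooth_on_def by (blast intro: Ck_on_const)

lemma smooth_on_add:
  "open S \<Longrightarrow> smooth_on S f \<Longrightarrow> smooth_on S g \<Longrightarrow> smooth_on S (\<lambda>x. f x + g x)"
  unfolding smooth_on_def by (blast intro: Ck_on_add)

lemma (in bounded_bilinear) smooth_on:
  "open S \<Longrightarrow> smooth_on S f \<Longrightarrow> smooth_on S g \<Longrightarrow> smooth_on S (\<lambda>x. prod (f x) (g x))"
  unfolding smooth_on_def by (blast intro: Ck_on)

lemmas smooth_on_mult = bounded_bilinear.smooth_on[OF bounded_bilinear_mult]
  and smooth_on_scaleR = bounded_bilinear.smooth_on[OF bounded_bilinear_scaleR]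
  and smooth_on_inner = bounded_bilinear.smooth_on[OF bounded_bilinear_inner]
  and smooth_on_cross3 = bounded_bilinear.smooth_on[OF
    bilinear_conv_bounded_bilinear[THEN iffD1, OF bilinear_cross]]

lemma smooth_on_inverse:
  fixes f :: "'e::euclidean_space \<Rightarrow> real"
  shows "open S \<Longrightarrow> smooth_on S f \<Longrightarrow> (\<And>x. x \<in> S \<Longrightarrow> f x \<noteq> 0) \<Longrightarrow> smooth_on S (\<lambda>x. inverse (f x))"
  unfolding smooth_on_def by (blast intro: Ck_on_inverse)

lemma smooth_on_sum:
  "open S \<Longrightarrow> (\<And>i. i \<in> I \<Longrightarrow> smooth_on S (f i)) \<Longrightarrow> smooth_on S (\<lambda>x. \<Sum>i\<in>I. f i x)"
  by (induction I rule: infinite_finite_induct) (auto intro: smooth_on_const smooth_on_add)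

lemma smooth_on_SucD: "smooth_on S f \<Longrightarrow> Ck_on (Suc k) S f"
  by (simp add: smooth_on_def del: Ck_on.simps)

lemma smooth_on_frechet_derivative:
  "smooth_on S f \<Longrightarrow> smooth_on S (\<lambda>x. frechet_derivative f (at x) v)"
  unfolding smooth_on_def[of S "\<lambda>x. frechet_derivative f (at x) v"]
  using Ck_on.simps(2)[THEN iffD1, OF smooth_on_SucD] by blast

lemma smooth_on_has_derivative:
  "smooth_on S f \<Longrightarrow> x \<in> S \<Longrightarrow> (f has_derivative frechet_derivative f (at x)) (at x)"
  using Ck_on_has_derivative[OF smooth_on_SucD] by blast

section \<open>Functions and vector fields on a manifold\<close>

locale smooth_manifold =
  fixes A :: "('a::{t2_space,second_countable_topology}, 'e::euclidean_space) chart set"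
  assumes atlas: "smooth_atlas A"
begin

lemma chart_cover: obtains U \<phi> where "(U, \<phi>) \<in> A" "p \<in> U"
proof -
  have "p \<in> (\<Union>(U, \<phi>)\<in>A. U)"
    using atlas unfolding smooth_atlas_def by simp
  then show thesis using that by auto
qed

lemma open_chart_image: "(U, \<phi>) \<in> A \<Longrightarrow> open (\<phi> ` U)"
  using atlas unfolding smooth_atlas_def by auto

lemma chart_inv: "(U, \<phi>) \<in> A \<Longrightarrow> p \<in> U \<Longrightarrow> inv_into U \<phi> (\<phi> p) = p"
  using atlas unfolding smooth_atlas_def homeomorphism_def by auto

lemma smooth_funD: "smooth_fun A f \<Longrightarrow> (U, \<phi>) \<in> A \<Longrightarrow> smooth_on (\<phi> ` U) (f \<circ> inv_into U \<phi>)"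
  unfolding smooth_fun_def by auto

lemma smooth_funI:
  "(\<And>U \<phi>. (U, \<phi>) \<in> A \<Longrightarrow> smooth_on (\<phi> ` U) (f \<circ> inv_into U \<phi>)) \<Longrightarrow> smooth_fun A f"
  unfolding smooth_fun_def by auto

lemma smooth_fun_const [simp]: "smooth_fun A (\<lambda>_. c)" "smooth_fun A 0"
  by (auto simp: o_def smooth_on_const intro!: smooth_funI)

lemma smooth_fun_add [simp]: "smooth_fun A f \<Longrightarrow> smooth_fun A h \<Longrightarrow> smooth_fun A (f + h)"
  using smooth_on_add[OF open_chart_image smooth_funD smooth_funD]
  by (auto simp: o_def intro!: smooth_funI)

lemma smooth_fun_mult [simp]: "smooth_fun A f \<Longrightarrow> smooth_fun A h \<Longrightarrow> smooth_fun A (f * h)"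
  using smooth_on_mult[OF open_chart_image smooth_funD smooth_funD]
  by (auto simp: o_def intro!: smooth_funI)

lemma smooth_fun_minus [simp]: "smooth_fun A f \<Longrightarrow> smooth_fun A (- f)"
  using smooth_fun_mult[of "\<lambda>_. - 1" f] by (simp add: times_fun_def fun_Compl_def)

lemma smooth_fun_diff [simp]: "smooth_fun A f \<Longrightarrow> smooth_fun A h \<Longrightarrow> smooth_fun A (f - h)"
  using smooth_fun_add[of f "- h"] by simp

lemma smooth_fun_scaleR [simp]: "smooth_fun A f \<Longrightarrow> smooth_fun A (c *\<^sub>R f)"
  using smooth_fun_mult[of "\<lambda>_. c" f] by (simp add: times_fun_def scaleR_fun_def)

lemma smooth_fun_has_derivative:
  assumes "smooth_fun A f" "(U, \<phi>) \<in> A" "p \<in> U"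
  shows "((f \<circ> inv_into U \<phi>) has_derivative
    frechet_derivative (f \<circ> inv_into U \<phi>) (at (\<phi> p))) (at (\<phi> p))"
  using smooth_on_has_derivative[OF smooth_funD[OF assms(1,2)]] assms(3) by blast

section \<open>Vector fields as derivations\<close>

lemma vector_fieldE:
  assumes "X \<in> vector_fields A" "(U, \<phi>) \<in> A"
  obtains w where "smooth_on (\<phi> ` U) w"
    "\<And>f p. smooth_fun A f \<Longrightarrow> p \<in> U \<Longrightarrow>
      X f p = frechet_derivative (f \<circ> inv_into U \<phi>) (at (\<phi> p)) (w (\<phi> p))"
proof -
  have "\<exists>w. smooth_on (\<phi> ` U) w \<and> (\<forall>f. smooth_fun A f \<longrightarrow>
      (\<forall>p\<in>U. X f p = frechet_derivative (f \<circ> inv_into U \<phi>) (at (\<phi> p)) (w (\<phi> p))))"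
    using assms unfolding vector_fields_def by fast
  then show thesis using that by blast
qed

lemma vector_fieldI:
  assumes "\<And>f. \<not> smooth_fun A f \<Longrightarrow> X f = 0"
    and "\<And>U \<phi>. (U, \<phi>) \<in> A \<Longrightarrow> \<exists>w. smooth_on (\<phi> ` U) w \<and>
      (\<forall>f p. smooth_fun A f \<longrightarrow> p \<in> U \<longrightarrow>
        X f p = frechet_derivative (f \<circ> inv_into U \<phi>) (at (\<phi> p)) (w (\<phi> p)))"
  shows "X \<in> vector_fields A"
  using assms unfolding vector_fields_def by fast

lemma vf_nonsmooth: "X \<in> vector_fields A \<Longrightarrow> \<not> smooth_fun A f \<Longrightarrow> X f = 0"
  unfolding vector_fields_def by auto

text \<open>At a fixed point, \<open>X\<close> differentiates along one vector \<open>v\<close>.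
  Admitting any derivative \<open>F\<close> in the conclusion lets the rules for sums, products and
  constants be inserted directly.\<close>

lemma vf_tangent_vector:
  assumes "X \<in> vector_fields A" "(U, \<phi>) \<in> A" "p \<in> U"
  obtains v where "\<And>f F. smooth_fun A f \<Longrightarrow>
    ((f \<circ> inv_into U \<phi>) has_derivative F) (at (\<phi> p)) \<Longrightarrow> X f p = F v"
proof -
  obtain w where "\<And>f p. smooth_fun A f \<Longrightarrow> p \<in> U \<Longrightarrow>
      X f p = frechet_derivative (f \<circ> inv_into U \<phi>) (at (\<phi> p)) (w (\<phi> p))"
    using vector_fieldE[OF assms(1,2)] by blast
  then show ?thesis
    using that[of "w (\<phi> p)"] assms(3) frechet_derivative_at by metis
qed

lemma vf_add:
  assumes "X \<in> vector_fields A" "smooth_fun A f" "smooth_fun A h"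
  shows "X (f + h) = X f + X h"
proof
  fix p
  obtain U \<phi> where c: "(U, \<phi>) \<in> A" "p \<in> U" by (rule chart_cover)
  obtain v where v: "\<And>f F. smooth_fun A f \<Longrightarrow>
    ((f \<circ> inv_into U \<phi>) has_derivative F) (at (\<phi> p)) \<Longrightarrow> X f p = F v"
    using vf_tangent_vector[OF assms(1) c] by blast
  note D = smooth_fun_has_derivative[OF _ c]
  have "((f + h) \<circ> inv_into U \<phi> has_derivative (\<lambda>x.
      frechet_derivative (f \<circ> inv_into U \<phi>) (at (\<phi> p)) x +
      frechet_derivative (h \<circ> inv_into U \<phi>) (at (\<phi> p)) x)) (at (\<phi> p))"
    using has_derivative_add[OF D[OF assms(2)] D[OF assms(3)]] by (simp add: o_def)
  from v[OF smooth_fun_add[OF assms(2,3)] this]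
  show "X (f + h) p = (X f + X h) p"
    using v[OF assms(2) D[OF assms(2)]] v[OF assms(3) D[OF assms(3)]] by simp
qed

lemma vf_mult:
  assumes "X \<in> vector_fields A" "smooth_fun A f" "smooth_fun A h"
  shows "X (f * h) = X f * h + f * X h"
proof
  fix p
  obtain U \<phi> where c: "(U, \<phi>) \<in> A" "p \<in> U" by (rule chart_cover)
  obtain v where v: "\<And>f F. smooth_fun A f \<Longrightarrow>
    ((f \<circ> inv_into U \<phi>) has_derivative F) (at (\<phi> p)) \<Longrightarrow> X f p = F v"
    using vf_tangent_vector[OF assms(1) c] by blast
  note D = smooth_fun_has_derivative[OF _ c]
  have "((f * h) \<circ> inv_into U \<phi> has_derivative (\<lambda>x.
      f p * frechet_derivative (h \<circ> inv_into U \<phi>) (at (\<phi> p)) x +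
      frechet_derivative (f \<circ> inv_into U \<phi>) (at (\<phi> p)) x * h p)) (at (\<phi> p))"
    using has_derivative_mult[OF D[OF assms(2)] D[OF assms(3)]] chart_inv[OF c] by (simp add: o_def)
  from v[OF smooth_fun_mult[OF assms(2,3)] this]
  show "X (f * h) p = (X f * h + f * X h) p"
    using v[OF assms(2) D[OF assms(2)]] v[OF assms(3) D[OF assms(3)]] by simp
qed

lemma vf_const:
  assumes "X \<in> vector_fields A"
  shows "X (\<lambda>_. c) = 0"
proof
  fix p
  obtain U \<phi> where c: "(U, \<phi>) \<in> A" "p \<in> U" by (rule chart_cover)
  obtain v where v: "\<And>f F. smooth_fun A f \<Longrightarrow>
    ((f \<circ> inv_into U \<phi>) has_derivative F) (at (\<phi> p)) \<Longrightarrow> X f p = F v"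
    using vf_tangent_vector[OF assms(1) c] by blast
  show "X (\<lambda>_. c) p = 0 p"
    using v[of "\<lambda>_. c" "\<lambda>_. 0"] by (simp add: o_def)
qed

lemma vf_zero: "X \<in> vector_fields A \<Longrightarrow> X 0 = 0"
  using vf_const[of X 0] by (simp add: zero_fun_def)

text \<open>In a chart, \<open>X f\<close> is a sum of the smooth components of \<open>w\<close>
  times the partial derivatives of \<open>f\<close>. On functions that are not smooth,
  \<open>X f\<close> is 0 by convention.\<close>

lemma smooth_fun_vf [simp]:
  assumes "X \<in> vector_fields A"
  shows "smooth_fun A (X f)"
proof (cases "smooth_fun A f")
  case True
  show ?thesis
  proof (rule smooth_funI)
    fix U \<phi> assume c: "(U, \<phi>) \<in> A"
    define F where "F = f \<circ> inv_into U \<phi>"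
    have F: "smooth_on (\<phi> ` U) F" unfolding F_def by (rule smooth_funD[OF True c])
    obtain w where w: "smooth_on (\<phi> ` U) w" "\<And>f p. smooth_fun A f \<Longrightarrow> p \<in> U \<Longrightarrow>
        X f p = frechet_derivative (f \<circ> inv_into U \<phi>) (at (\<phi> p)) (w (\<phi> p))"
      using vector_fieldE[OF assms(1) c] by blast
    have S: "smooth_on (\<phi> ` U) (\<lambda>y. \<Sum>b\<in>Basis. (w y \<bullet> b) * frechet_derivative F (at y) b)"
      by (intro smooth_on_sum smooth_on_mult smooth_on_inner smooth_on_const w
          smooth_on_frechet_derivative F open_chart_image[OF c])
    show "smooth_on (\<phi> ` U) (X f \<circ> inv_into U \<phi>)"
    proof (rule smooth_on_cong[OF open_chart_image[OF c] S])
      fix y assume "y \<in> \<phi> ` U"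
      then obtain p where p: "p \<in> U" "y = \<phi> p" by auto
      have "linear (frechet_derivative F (at y))"
        using smooth_on_has_derivative[OF F] p has_derivative_linear by blast
      then have "frechet_derivative F (at y) (\<Sum>b\<in>Basis. (w y \<bullet> b) *\<^sub>R b) =
          (\<Sum>b\<in>Basis. (w y \<bullet> b) * frechet_derivative F (at y) b)"
        by (simp add: linear_sum linear_scale)
      then show "(\<Sum>b\<in>Basis. (w y \<bullet> b) * frechet_derivative F (at y) b) = (X f \<circ> inv_into U \<phi>) y"
        using w(2)[OF True p(1)] p chart_inv[OF c p(1)] by (simp add: euclidean_representation F_def)
    qed
  qed
qed (simp add: vf_nonsmooth[OF assms])

lemma vector_fields_add [simp]:
  assumes "X \<in> vector_fields A" "Y \<in> vector_fields A"
  shows "X + Y \<in> vector_fields A"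
proof (rule vector_fieldI)
  fix U \<phi> assume c: "(U, \<phi>) \<in> A"
  obtain w where w: "smooth_on (\<phi> ` U) w" "\<And>f p. smooth_fun A f \<Longrightarrow> p \<in> U \<Longrightarrow>
      X f p = frechet_derivative (f \<circ> inv_into U \<phi>) (at (\<phi> p)) (w (\<phi> p))"
    using vector_fieldE[OF assms(1) c] by blast
  obtain w' where w': "smooth_on (\<phi> ` U) w'" "\<And>f p. smooth_fun A f \<Longrightarrow> p \<in> U \<Longrightarrow>
      Y f p = frechet_derivative (f \<circ> inv_into U \<phi>) (at (\<phi> p)) (w' (\<phi> p))"
    using vector_fieldE[OF assms(2) c] by blast
  show "\<exists>w. smooth_on (\<phi> ` U) w \<and> (\<forall>f p. smooth_fun A f \<longrightarrow> p \<in> U \<longrightarrow>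
      (X + Y) f p = frechet_derivative (f \<circ> inv_into U \<phi>) (at (\<phi> p)) (w (\<phi> p)))"
    using w w' smooth_on_add[OF open_chart_image[OF c] w(1) w'(1)]
      smooth_fun_has_derivative[OF _ c, THEN has_derivative_linear, THEN linear_add]
    by (intro exI[of _ "\<lambda>y. w y + w' y"]) simp
qed (simp add: vf_nonsmooth assms fun_eq_iff)

lemma vector_fields_fmult [simp]:
  assumes "smooth_fun A h" "X \<in> vector_fields A"
  shows "fmult h X \<in> vector_fields A"
proof (rule vector_fieldI)
  fix U \<phi> assume c: "(U, \<phi>) \<in> A"
  obtain w where w: "smooth_on (\<phi> ` U) w" "\<And>f p. smooth_fun A f \<Longrightarrow> p \<in> U \<Longrightarrow>
      X f p = frechet_derivative (f \<circ> inv_into U \<phi>) (at (\<phi> p)) (w (\<phi> p))"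
    using vector_fieldE[OF assms(2) c] by blast
  show "\<exists>w. smooth_on (\<phi> ` U) w \<and> (\<forall>f p. smooth_fun A f \<longrightarrow> p \<in> U \<longrightarrow>
      fmult h X f p = frechet_derivative (f \<circ> inv_into U \<phi>) (at (\<phi> p)) (w (\<phi> p)))"
    using w smooth_on_scaleR[OF open_chart_image[OF c] smooth_funD[OF assms(1) c] w(1)]
      smooth_fun_has_derivative[OF _ c, THEN has_derivative_linear, THEN linear_scale]
    by (intro exI[of _ "\<lambda>y. (h \<circ> inv_into U \<phi>) y *\<^sub>R w y"]) (simp add: fmult_def chart_inv[OF c])
qed (simp add: fmult_def vf_nonsmooth assms fun_eq_iff)

text \<open>Real multiples, negatives and differences become multiplications by constant functions,
  so their rules follow from additivity and the rules for \<open>fmult\<close>.\<close>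

lemma scaleR_eq_fmult: "c *\<^sub>R X = fmult (\<lambda>_. c) (X :: 'a vfield)"
  by (simp add: fmult_def scaleR_fun_def fun_eq_iff)

lemma uminus_eq_fmult: "- X = fmult (\<lambda>_. - 1) (X :: 'a vfield)"
  by (simp add: fmult_def fun_eq_iff)

lemma diff_eq_fmult: "X - Y = X + fmult (\<lambda>_. - 1) (Y :: 'a vfield)"
  by (simp add: fmult_def fun_eq_iff)

lemma vector_fields_scaleR [simp]: "X \<in> vector_fields A \<Longrightarrow> c *\<^sub>R X \<in> vector_fields A"
  by (simp add: scaleR_eq_fmult)

lemma vector_fields_uminus [simp]: "X \<in> vector_fields A \<Longrightarrow> - X \<in> vector_fields A"
  by (simp add: uminus_eq_fmult)

lemma vector_fields_diff [simp]:
  "X \<in> vector_fields A \<Longrightarrow> Y \<in> vector_fields A \<Longrightarrow> X - Y \<in> vector_fields A"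
  by (simp add: diff_eq_fmult)

lemma vector_fields_zero [simp]: "0 \<in> vector_fields A"
  by (auto intro!: vector_fieldI exI[of _ "\<lambda>_. 0"] simp: smooth_on_const
      linear_0[OF has_derivative_linear[OF smooth_fun_has_derivative]])

end

section \<open>Tensors and affine connections\<close>

text \<open>\<open>sym_tensor2\<close> imposes linearity on the first slot only and leaves the
  second to symmetry. The Ricci tensor of a connection with torsion need not be symmetric, so here
  both slots are constrained.\<close>

definition tensor2 ::
  "('a, 'e::euclidean_space) chart set \<Rightarrow> ('a vfield \<Rightarrow> 'a vfield \<Rightarrow> 'a \<Rightarrow> real) \<Rightarrow> bool"
  where "tensor2 A T \<longleftrightarrow>
    (\<forall>X\<in>vector_fields A. \<forall>Y\<in>vector_fields A. smooth_fun A (T X Y)) \<and>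
    (\<forall>X\<in>vector_fields A. \<forall>Y\<in>vector_fields A. \<forall>Z\<in>vector_fields A.
       T (X + Y) Z = T X Z + T Y Z \<and> T X (Y + Z) = T X Y + T X Z) \<and>
    (\<forall>f. smooth_fun A f \<longrightarrow> (\<forall>X\<in>vector_fields A. \<forall>Y\<in>vector_fields A.
       T (fmult f X) Y = f * T X Y \<and> T X (fmult f Y) = f * T X Y))"

lemma sym_tensor2_imp_tensor2:
  assumes "smooth_manifold A" "sym_tensor2 A g"
  shows "tensor2 A g"
proof -
  interpret smooth_manifold A by fact
  have sym: "g X Y = g Y X" if "X \<in> vector_fields A" "Y \<in> vector_fields A" for X Y
    using assms(2) that unfolding sym_tensor2_def by blast
  have add: "g (X + Y) Z = g X Z + g Y Z"
    if "X \<in> vector_fields A" "Y \<in> vector_fields A" "Z \<in> vector_fields A" for X Y Z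
    using assms(2) that unfolding sym_tensor2_def by blast
  have mult: "g (fmult f X) Y = f * g X Y"
    if "smooth_fun A f" "X \<in> vector_fields A" "Y \<in> vector_fields A" for f X Y
    using assms(2) that unfolding sym_tensor2_def by blast
  have "g Z (X + Y) = g Z X + g Z Y"
    if "X \<in> vector_fields A" "Y \<in> vector_fields A" "Z \<in> vector_fields A" for X Y Z
    using add[OF that] sym[OF vector_fields_add[OF that(1,2)] that(3)] sym[OF that(1,3)]
      sym[OF that(2,3)] by metis
  moreover have "g Y (fmult f X) = f * g Y X"
    if "smooth_fun A f" "X \<in> vector_fields A" "Y \<in> vector_fields A" for f X Y
    using mult[OF that] sym[OF vector_fields_fmult[OF that(1,2)] that(3)] sym[OF that(2,3)] by metis
  ultimately show ?thesis
    using assms(2) add mult unfolding tensor2_def sym_tensor2_def by blast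
qed

context smooth_manifold
begin

lemma tensor2_smooth:
  "tensor2 A T \<Longrightarrow> X \<in> vector_fields A \<Longrightarrow> Y \<in> vector_fields A \<Longrightarrow> smooth_fun A (T X Y)"
  unfolding tensor2_def by blast

lemma tensor2_add:
  assumes "tensor2 A T" "X \<in> vector_fields A" "Y \<in> vector_fields A" "Z \<in> vector_fields A"
  shows "T (X + Y) Z = T X Z + T Y Z" "T X (Y + Z) = T X Y + T X Z"
  using assms unfolding tensor2_def by blast+

lemma tensor2_fmult:
  assumes "tensor2 A T" "smooth_fun A f" "X \<in> vector_fields A" "Y \<in> vector_fields A"
  shows "T (fmult f X) Y = f * T X Y" "T X (fmult f Y) = f * T X Y"
  using assms unfolding tensor2_def by blast+

lemma tensor2_linear:
  assumes "tensor2 A T" "X \<in> vector_fields A" "Y \<in> vector_fields A"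
  shows "T (c *\<^sub>R X) Y = c *\<^sub>R T X Y" "T X (c *\<^sub>R Y) = c *\<^sub>R T X Y"
    "T (- X) Y = - T X Y" "T X (- Y) = - T X Y"
    and "Z \<in> vector_fields A \<Longrightarrow> T (X - Z) Y = T X Y - T Z Y"
    and "Z \<in> vector_fields A \<Longrightarrow> T X (Y - Z) = T X Y - T X Z"
proof -
  show "T (c *\<^sub>R X) Y = c *\<^sub>R T X Y" "T X (c *\<^sub>R Y) = c *\<^sub>R T X Y"
    "T (- X) Y = - T X Y" "T X (- Y) = - T X Y"
    using assms by (simp_all add: scaleR_eq_fmult uminus_eq_fmult tensor2_fmult[OF assms(1)])
      (simp_all add: fun_eq_iff scaleR_fun_def)
  show "T (X - Z) Y = T X Y - T Z Y" "T X (Y - Z) = T X Y - T X Z" if "Z \<in> vector_fields A"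
    using assms that
    by (simp_all add: diff_eq_fmult tensor2_add[OF assms(1)] tensor2_fmult[OF assms(1)])
      (simp_all add: fun_eq_iff)
qed

lemma tensor2_zero:
  assumes "tensor2 A T" "X \<in> vector_fields A"
  shows "T 0 X = 0" "T X 0 = 0"
  using tensor2_add(1)[of T 0 0 X] tensor2_add(2)[of T X 0 0] assms by simp_all

lemmas tensor2_simps = tensor2_smooth tensor2_add tensor2_fmult tensor2_linear tensor2_zero

section \<open>Lie brackets, connections and (1,1)-tensors\<close>

lemma lie_bracket_skew: "lie_bracket X Y = - lie_bracket Y (X :: 'a vfield)"
  by (simp add: lie_bracket_def fun_eq_iff)

lemma lie_bracket_self [simp]: "lie_bracket X X = (0 :: 'a vfield)"
  by (simp add: lie_bracket_def fun_eq_iff)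

lemma lie_bracket_add [simp]:
  assumes "X \<in> vector_fields A" "Y \<in> vector_fields A" "Z \<in> vector_fields A"
  shows "lie_bracket (X + Y) Z = lie_bracket X Z + lie_bracket Y Z"
    "lie_bracket Z (X + Y) = lie_bracket Z X + lie_bracket Z Y"
  using assms by (simp_all add: lie_bracket_def vf_add[OF assms(3)] fun_eq_iff)

text \<open>The product rule can be applied whatever the argument \<open>h\<close> of the operators
  is, because \<open>X h\<close> and \<open>Y h\<close> are smooth for every
  \<open>h\<close>.\<close>

lemma lie_bracket_fmult:
  assumes "X \<in> vector_fields A" "Y \<in> vector_fields A" "smooth_fun A f"
  shows "lie_bracket (fmult f X) Y = fmult f (lie_bracket X Y) - fmult (Y f) X"
    "lie_bracket X (fmult f Y) = fmult f (lie_bracket X Y) + fmult (X f) Y"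
  using assms by (simp_all add: lie_bracket_def fmult_def vf_mult[OF assms(1)] vf_mult[OF assms(2)] fun_eq_iff
      algebra_simps)

lemma fmult_zero [simp]: "fmult 0 (X :: 'a vfield) = 0"
  by (simp add: fmult_def fun_eq_iff)

lemma lie_bracket_scaleR [simp]:
  assumes "X \<in> vector_fields A" "Y \<in> vector_fields A"
  shows "lie_bracket (c *\<^sub>R X) Y = c *\<^sub>R lie_bracket X Y" "lie_bracket X (c *\<^sub>R Y) = c *\<^sub>R lie_bracket X Y"
  using assms
  by (simp_all add: scaleR_eq_fmult lie_bracket_fmult vf_const[OF assms(1)] vf_const[OF assms(2)])

lemma affine_connection_closed:
  "affine_connection A D \<Longrightarrow> X \<in> vector_fields A \<Longrightarrow> Y \<in> vector_fields A \<Longrightarrow> D X Y \<in> vector_fields A"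
  unfolding affine_connection_def by blast

lemma affine_connection_add:
  assumes "affine_connection A D" "X \<in> vector_fields A" "Y \<in> vector_fields A" "Z \<in> vector_fields A"
  shows "D (X + Y) Z = D X Z + D Y Z" "D X (Y + Z) = D X Y + D X Z"
  using assms unfolding affine_connection_def by blast+

lemma affine_connection_fmult:
  assumes "affine_connection A D" "smooth_fun A f" "X \<in> vector_fields A" "Y \<in> vector_fields A"
  shows "D (fmult f X) Y = fmult f (D X Y)" "D X (fmult f Y) = fmult (X f) Y + fmult f (D X Y)"
  using assms unfolding affine_connection_def by blast+

lemma affine_connection_linear:
  assumes "affine_connection A D" "X \<in> vector_fields A" "Y \<in> vector_fields A"
  shows "D (c *\<^sub>R X) Y = c *\<^sub>R D X Y" "D X (c *\<^sub>R Y) = c *\<^sub>R D X Y"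
    "D (- X) Y = - D X Y" "D X (- Y) = - D X Y"
    and "Z \<in> vector_fields A \<Longrightarrow> D (X - Z) Y = D X Y - D Z Y"
    and "Z \<in> vector_fields A \<Longrightarrow> D X (Y - Z) = D X Y - D X Z"
proof -
  show "D (c *\<^sub>R X) Y = c *\<^sub>R D X Y" "D X (c *\<^sub>R Y) = c *\<^sub>R D X Y"
    "D (- X) Y = - D X Y" "D X (- Y) = - D X Y"
    using assms
    by (simp_all add: scaleR_eq_fmult uminus_eq_fmult affine_connection_closed[OF assms(1)]
        affine_connection_fmult[OF assms(1)] vf_const[OF assms(2)])
  show "D (X - Z) Y = D X Y - D Z Y" "D X (Y - Z) = D X Y - D X Z" if "Z \<in> vector_fields A"
    using assms that by (simp_all add: diff_eq_fmult affine_connection_closed[OF assms(1)]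
        affine_connection_add[OF assms(1)]        affine_connection_fmult[OF assms(1)] vf_const[OF assms(2)])
qed

lemma affine_connection_zero:
  assumes "affine_connection A D" "X \<in> vector_fields A"
  shows "D 0 X = 0" "D X 0 = 0"
  using affine_connection_add(1)[of D 0 0 X] affine_connection_add(2)[of D X 0 0] assms
  by simp_all

lemmas affine_connection_simps = affine_connection_closed affine_connection_add
  affine_connection_fmult affine_connection_linear affine_connection_zero

lemma tensor11_closed: "tensor11 A J \<Longrightarrow> X \<in> vector_fields A \<Longrightarrow> J X \<in> vector_fields A"
  unfolding tensor11_def by blast

lemma tensor11_add:
  "tensor11 A J \<Longrightarrow> X \<in> vector_fields A \<Longrightarrow> Y \<in> vector_fields A \<Longrightarrow> J (X + Y) = J X + J Y"
  unfolding tensor11_def by blast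

lemma tensor11_fmult:
  "tensor11 A J \<Longrightarrow> smooth_fun A f \<Longrightarrow> X \<in> vector_fields A \<Longrightarrow> J (fmult f X) = fmult f (J X)"
  unfolding tensor11_def by blast

lemma tensor11_linear:
  assumes "tensor11 A J" "X \<in> vector_fields A"
  shows "J (c *\<^sub>R X) = c *\<^sub>R J X" "J (- X) = - J X"
    and "Y \<in> vector_fields A \<Longrightarrow> J (X - Y) = J X - J Y"
  using assms(2)
  by (simp_all add: scaleR_eq_fmult uminus_eq_fmult diff_eq_fmult tensor11_add[OF assms(1)]
      tensor11_closed[OF assms(1)] tensor11_fmult[OF assms(1)])

lemma tensor11_zero: "tensor11 A J \<Longrightarrow> J 0 = 0"
  using tensor11_add[of J 0 0] by simp

lemmas tensor11_simps = tensor11_closed tensor11_add tensor11_fmult tensor11_linear tensor11_zero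

text \<open>In the second slot, both \<open>D X (J (fmult f Y))\<close> and
  \<open>J (D X (fmult f Y))\<close> produce the term \<open>fmult (X f) (J Y)\<close>, which
  cancels in the difference.\<close>

lemma cov_deriv11_tensorial [simp]:
  assumes "affine_connection A D" "tensor11 A J"
    "X \<in> vector_fields A" "Y \<in> vector_fields A"
  shows "cov_deriv11 D J X Y \<in> vector_fields A"
    and "Z \<in> vector_fields A \<Longrightarrow> cov_deriv11 D J (X + Y) Z = cov_deriv11 D J X Z + cov_deriv11 D J Y Z"
    and "Z \<in> vector_fields A \<Longrightarrow> cov_deriv11 D J X (Y + Z) = cov_deriv11 D J X Y + cov_deriv11 D J X Z"
    and "smooth_fun A f \<Longrightarrow> cov_deriv11 D J (fmult f X) Y = fmult f (cov_deriv11 D J X Y)"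
    and "smooth_fun A f \<Longrightarrow> cov_deriv11 D J X (fmult f Y) = fmult f (cov_deriv11 D J X Y)"
  using assms(3,4) assms(1,2)
  by (simp_all add: cov_deriv11_def affine_connection_simps[OF assms(1)] tensor11_simps[OF assms(2)])
    (simp_all add: fmult_def fun_eq_iff algebra_simps)

text \<open>The corrections added to \<open>D\<close> are function-linear in both slots, so the
  Leibniz rule of \<open>D\<close> survives.\<close>

lemma affine_connection_KN:
  assumes "affine_connection A D" "tensor11 A J"
  shows "affine_connection A (kobayashi_nomizu_connection D J)"
  unfolding affine_connection_def kobayashi_nomizu_connection_def canonical_connection_def
  using assms
  by (simp add: affine_connection_simps[OF assms(1)] tensor11_simps[OF assms(2)])
    (simp add: fmult_def fun_eq_iff scaleR_fun_def algebra_simps)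

lemma tensor2_symmetrize:
  assumes "tensor2 A T"
  shows "tensor2 A (symmetrize T)"
  using assms unfolding tensor2_def[of A "symmetrize T"] symmetrize_def
  by (simp add: tensor2_simps[OF assms]) (simp add: fun_eq_iff scaleR_fun_def algebra_simps)

end

section \<open>Framed manifolds\<close>

locale framed_manifold = smooth_manifold A
  for A :: "('a::{t2_space,second_countable_topology}, 'e::euclidean_space) chart set" +
  fixes e1 e2 e3 :: "'a vfield"
  assumes frame_closed [simp]:
    "e1 \<in> vector_fields A" "e2 \<in> vector_fields A" "e3 \<in> vector_fields A"
  and frame_brackets:
    "lie_bracket e1 e2 \<in> vector_fields A" "lie_bracket e1 e3 \<in> vector_fields A"
    "lie_bracket e2 e3 \<in> vector_fields A"
  and frame_expansion: "X \<in> vector_fields A \<Longrightarrow> \<exists>a b c. smooth_fun A a \<and> smooth_fun A b \<and>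
    smooth_fun A c \<and> X = fmult a e1 + fmult b e2 + fmult c e3"
begin

lemma frame_expansionE:
  assumes "X \<in> vector_fields A"
  obtains a b c where "smooth_fun A a" "smooth_fun A b" "smooth_fun A c"
    "X = fmult a e1 + fmult b e2 + fmult c e3"
  using frame_expansion[OF assms] by blast

text \<open>A proof in charts would rest on the symmetry of second derivatives. With a global frame
  it is enough that the frame brackets are fields: \<open>lie_bracket_fmult\<close> extends this to
  smooth combinations, one slot at a time.\<close>

lemma lie_bracket_closed [simp]:
  assumes "X \<in> vector_fields A" "Y \<in> vector_fields A"
  shows "lie_bracket X Y \<in> vector_fields A"
proof -
  have frame: "lie_bracket e Y \<in> vector_fields A" if e: "e \<in> {e1, e2, e3}" for e
  proof -
    have e': "e \<in> vector_fields A" using e by auto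
    have "lie_bracket e2 e1 \<in> vector_fields A" "lie_bracket e3 e1 \<in> vector_fields A"
      "lie_bracket e3 e2 \<in> vector_fields A"
      using frame_brackets[THEN vector_fields_uminus] by (simp_all only: lie_bracket_skew[symmetric])
    then have "lie_bracket e e1 \<in> vector_fields A" "lie_bracket e e2 \<in> vector_fields A"
      "lie_bracket e e3 \<in> vector_fields A"
      using e frame_brackets by auto
    note this [simp]
    obtain a b c where "smooth_fun A a" "smooth_fun A b" "smooth_fun A c"
      and "Y = fmult a e1 + fmult b e2 + fmult c e3"
      by (rule frame_expansionE[OF assms(2)])
    then show ?thesis by (simp add: e' lie_bracket_fmult)
  qed
  obtain a b c where "smooth_fun A a" "smooth_fun A b" "smooth_fun A c"
    and "X = fmult a e1 + fmult b e2 + fmult c e3"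
    by (rule frame_expansionE[OF assms(1)])
  then show ?thesis by (simp add: assms(2) frame lie_bracket_fmult)
qed

text \<open>The term \<open>\<xi> f * T X Y\<close> arising from the product rule cancels against
  the one from \<open>lie_bracket \<xi> (fmult f X)\<close>; likewise in the second slot.\<close>

lemma tensor2_lie_derivative2:
  assumes "tensor2 A T" "\<xi> \<in> vector_fields A"
  shows "tensor2 A (lie_derivative2 \<xi> T)"
  using assms unfolding tensor2_def[of A "lie_derivative2 \<xi> T"] lie_derivative2_def
  by (simp add: vf_add[OF assms(2)] vf_mult[OF assms(2)] lie_bracket_fmult tensor2_simps[OF assms(1)])
    (simp add: fun_eq_iff algebra_simps)

text \<open>Reduces the collineation condition, which quantifies over all vector fields, to the nine
  pairs of frame fields.\<close>

lemma tensor2_eq_0: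
  assumes "tensor2 A T" "\<And>X Y. X \<in> {e1, e2, e3} \<Longrightarrow> Y \<in> {e1, e2, e3} \<Longrightarrow> T X Y = 0"
    "X \<in> vector_fields A" "Y \<in> vector_fields A"
  shows "T X Y = 0"
proof -
  have *: "T e Y = 0" if "e \<in> {e1, e2, e3}" for e
  proof -
    have e: "e \<in> vector_fields A" using that by auto
    have "T e e1 = 0" "T e e2 = 0" "T e e3 = 0" using assms(2) that by auto
    note this [simp]
    obtain a b c where "smooth_fun A a" "smooth_fun A b" "smooth_fun A c"
      and "Y = fmult a e1 + fmult b e2 + fmult c e3"
      by (rule frame_expansionE[OF assms(4)])
    then show ?thesis by (simp add: tensor2_simps[OF assms(1)] e)
  qed
  obtain a b c where "smooth_fun A a" "smooth_fun A b" "smooth_fun A c"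
    and "X = fmult a e1 + fmult b e2 + fmult c e3"
    by (rule frame_expansionE[OF assms(3)])
  then show ?thesis by (simp add: tensor2_simps[OF assms(1)] assms(4) *)
qed

lemma curvature_closed:
  assumes "affine_connection A D" "X \<in> vector_fields A" "Y \<in> vector_fields A" "Z \<in> vector_fields A"
  shows "curvature D X Y Z \<in> vector_fields A"
  using assms by (simp add: curvature_def affine_connection_simps[OF assms(1)])

lemma curvature_add:
  assumes "affine_connection A D" "X \<in> vector_fields A" "Y \<in> vector_fields A" "Z \<in> vector_fields A"
    "W \<in> vector_fields A"
  shows "curvature D (X + W) Y Z = curvature D X Y Z + curvature D W Y Z"
    "curvature D X Y (Z + W) = curvature D X Y Z + curvature D X Y W"
  using assms by (simp_all add: curvature_def affine_connection_simps[OF assms(1)])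

text \<open>Only the first and third slots are treated: the Ricci contraction puts its arguments
  there and fills the second slot with frame fields. In the third slot the second derivatives of
  \<open>f\<close> form \<open>lie_bracket X Y f\<close> and cancel.\<close>

lemma curvature_fmult:
  assumes "affine_connection A D" "X \<in> vector_fields A" "Y \<in> vector_fields A" "Z \<in> vector_fields A"
    "smooth_fun A f"
  shows "curvature D (fmult f X) Y Z = fmult f (curvature D X Y Z)"
    "curvature D X Y (fmult f Z) = fmult f (curvature D X Y Z)"
  using assms by (simp_all add: curvature_def lie_bracket_fmult affine_connection_simps[OF assms(1)])
    (simp_all add: fmult_def fun_eq_iff lie_bracket_def algebra_simps)

lemma tensor2_ricci:
  assumes "affine_connection A D" "tensor2 A g"
  shows "tensor2 A (ricci g D e1 e2 e3)"
  using assms unfolding tensor2_def[of A "ricci g D e1 e2 e3"] ricci_def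
  by (simp add: curvature_closed curvature_add curvature_fmult tensor2_simps[OF assms(2)]) (simp add: fun_eq_iff algebra_simps)

end

section \<open>Left-invariant frames\<close>

text \<open>The triple product is the determinant of the matrix with rows \<open>u\<close>,
  \<open>v\<close>, \<open>w\<close>, and independent rows make that matrix invertible.\<close>

lemma cross3_triple_nonzero:
  fixes u v w :: "real^3"
  assumes "\<And>a b c. a *\<^sub>R u + b *\<^sub>R v + c *\<^sub>R w = 0 \<Longrightarrow> a = 0 \<and> b = 0 \<and> c = 0"
  shows "u \<bullet> cross3 v w \<noteq> 0"
proof -
  let ?M = "vector [u, v, w] :: real^3^3"
  have "\<forall>i. k i = 0" if "(\<Sum>i\<in>UNIV. k i *s row i ?M) = 0" for k :: "3 \<Rightarrow> real"
  proof -
    have r: "row 1 ?M = u" "row 2 ?M = v" "row 3 ?M = w"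
      by (simp_all add: row_def vec_eq_iff)
    have "k 1 *\<^sub>R u + k 2 *\<^sub>R v + k 3 *\<^sub>R w = 0"
      using that by (simp add: sum_3 r scalar_mult_eq_scaleR)
    then show ?thesis using assms by (simp add: forall_3)
  qed
  then have "\<exists>B. ?M ** B = mat 1"
    by (simp only: matrix_right_invertible_independent_rows) blast
  then show ?thesis
    by (simp add: dot_cross_det invertible_right_inverse flip: invertible_det_nz)
qed

text \<open>Cramer's rule with the denominator cleared: a polynomial identity in the coordinates,
  valid for dependent vectors too.\<close>

lemma cross3_cramer:
  fixes u v w x :: "real^3"
  shows "(u \<bullet> cross3 v w) *\<^sub>R x =
    (x \<bullet> cross3 v w) *\<^sub>R u + (u \<bullet> cross3 x w) *\<^sub>R v + (u \<bullet> cross3 v x) *\<^sub>R w"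
  by (simp add: cross3_simps forall_3)

text \<open>Left translations need not be known to preserve smoothness here, since vector fields annihilate
  functions that are not smooth.\<close>

lemma left_inv_field_eq_0:
  assumes "group mul idt iv" "X \<in> left_inv_fields A mul iv" "\<And>f. X f p = 0"
  shows "X = 0"
proof (intro ext)
  fix f q
  interpret group mul idt iv by fact
  \<comment> \<open>Left translation by this element takes \<open>p\<close> to \<open>q\<close>, so
    the value at \<open>q\<close> is read off at \<open>p\<close>.\<close>
  let ?a = "mul q (iv p)"
  have "X f q = push_left mul iv ?a X f q"
    using assms(2) unfolding left_inv_fields_def by auto
  also have "\<dots> = X (\<lambda>r. f (mul ?a r)) p"
    by (simp add: push_left_def inverse_distrib_swap assoc)
  finally show "X f q = 0 f q" using assms(3) by simp
qed

section \<open>Expansion of vector fields in a global frame\<close>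

locale manifold3 = smooth_manifold A
  for A :: "('a::{t2_space,second_countable_topology}, real^3) chart set"
begin

text \<open>Pointwise independence makes the triple product of the three coefficient vectors nowhere
  zero on the chart, so the quotients of Cramer's rule are smooth.\<close>

lemma local_frame_expansion:
  assumes VF: "e1 \<in> vector_fields A" "e2 \<in> vector_fields A" "e3 \<in> vector_fields A"
    "X \<in> vector_fields A"
    and indep: "\<And>p a b c. \<forall>f. a * e1 f p + b * e2 f p + c * e3 f p = 0 \<Longrightarrow> a = 0 \<and> b = 0 \<and> c = 0"
    and chart: "(U, \<phi>) \<in> A"
  obtains a b c where "smooth_on (\<phi> ` U) a" "smooth_on (\<phi> ` U) b" "smooth_on (\<phi> ` U) c"
    "\<And>f p. p \<in> U \<Longrightarrow> X f p = a (\<phi> p) * e1 f p + b (\<phi> p) * e2 f p + c (\<phi> p) * e3 f p"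
proof -
  define F where "F f p = frechet_derivative (f \<circ> inv_into U \<phi>) (at (\<phi> p))"
    for f :: "'a \<Rightarrow> real" and p
  obtain u where u: "smooth_on (\<phi> ` U) u" "\<And>f p. smooth_fun A f \<Longrightarrow> p \<in> U \<Longrightarrow> e1 f p = F f p (u (\<phi> p))"
    using vector_fieldE[OF VF(1) chart] unfolding F_def by blast
  obtain v where v: "smooth_on (\<phi> ` U) v" "\<And>f p. smooth_fun A f \<Longrightarrow> p \<in> U \<Longrightarrow> e2 f p = F f p (v (\<phi> p))"
    using vector_fieldE[OF VF(2) chart] unfolding F_def by blast
  obtain w where w: "smooth_on (\<phi> ` U) w" "\<And>f p. smooth_fun A f \<Longrightarrow> p \<in> U \<Longrightarrow> e3 f p = F f p (w (\<phi> p))"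
    using vector_fieldE[OF VF(3) chart] unfolding F_def by blast
  obtain x where x: "smooth_on (\<phi> ` U) x" "\<And>f p. smooth_fun A f \<Longrightarrow> p \<in> U \<Longrightarrow> X f p = F f p (x (\<phi> p))"
    using vector_fieldE[OF VF(4) chart] unfolding F_def by blast
  have lin: "linear (F f p)" if "smooth_fun A f" "p \<in> U" for f p
    using smooth_fun_has_derivative[OF that(1) chart that(2)] has_derivative_linear
    unfolding F_def by blast
  define d where "d y = u y \<bullet> cross3 (v y) (w y)" for y
  have d: "d y \<noteq> 0" if "y \<in> \<phi> ` U" for y
    unfolding d_def
  proof (rule cross3_triple_nonzero)
    \<comment> \<open>Since the derivative of \<open>f\<close> is linear, a relation between
      coefficient vectors at \<open>y\<close> is a relation between the fields at \<open>p\<close>.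
      For \<open>f\<close> not smooth, all terms are 0.\<close>
    fix a b c assume 0: "a *\<^sub>R u y + b *\<^sub>R v y + c *\<^sub>R w y = 0"
    obtain p where p: "p \<in> U" "y = \<phi> p" using \<open>y \<in> \<phi> ` U\<close> by auto
    show "a = 0 \<and> b = 0 \<and> c = 0"
    proof (rule indep[of a p b c], rule allI)
      fix f
      show "a * e1 f p + b * e2 f p + c * e3 f p = 0"
      proof (cases "smooth_fun A f")
        case True
        have "F f p (a *\<^sub>R u y + b *\<^sub>R v y + c *\<^sub>R w y) = 0"
          unfolding 0 using lin[OF True p(1)] linear_0 by blast
        then show ?thesis
          using lin[OF True p(1)]
          by (simp add: u(2) v(2) w(2) True p linear_add linear_scale)
      qed (simp add: vf_nonsmooth VF)
    qed
  qed
  note o = open_chart_image[OF chart]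
  \<comment> \<open>Division by \<open>d\<close> preserves smoothness.\<close>
  note smooth = smooth_on_mult[OF o smooth_on_inverse[OF o smooth_on_inner[OF o u(1)
    smooth_on_cross3[OF o v(1) w(1)]] d[unfolded d_def]], folded d_def]
  show thesis
  proof (rule that)
    show "smooth_on (\<phi> ` U) (\<lambda>y. inverse (d y) * (x y \<bullet> cross3 (v y) (w y)))"
      by (intro smooth smooth_on_inner[OF o] smooth_on_cross3[OF o] u(1) v(1) w(1) x(1))
    show "smooth_on (\<phi> ` U) (\<lambda>y. inverse (d y) * (u y \<bullet> cross3 (x y) (w y)))"
      by (intro smooth smooth_on_inner[OF o] smooth_on_cross3[OF o] u(1) v(1) w(1) x(1))
    show "smooth_on (\<phi> ` U) (\<lambda>y. inverse (d y) * (u y \<bullet> cross3 (v y) (x y)))"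
      by (intro smooth smooth_on_inner[OF o] smooth_on_cross3[OF o] u(1) v(1) w(1) x(1))
    fix f p assume p: "p \<in> U"
    let ?y = "\<phi> p"
    show "X f p = inverse (d ?y) * (x ?y \<bullet> cross3 (v ?y) (w ?y)) * e1 f p
        + inverse (d ?y) * (u ?y \<bullet> cross3 (x ?y) (w ?y)) * e2 f p
        + inverse (d ?y) * (u ?y \<bullet> cross3 (v ?y) (x ?y)) * e3 f p"
    proof (cases "smooth_fun A f")
      case True
      have cramer: "d ?y *\<^sub>R x ?y = (x ?y \<bullet> cross3 (v ?y) (w ?y)) *\<^sub>R u ?y
          + (u ?y \<bullet> cross3 (x ?y) (w ?y)) *\<^sub>R v ?y + (u ?y \<bullet> cross3 (v ?y) (x ?y)) *\<^sub>R w ?y"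
        unfolding d_def by (rule cross3_cramer)
      have "d ?y * X f p = F f p (d ?y *\<^sub>R x ?y)"
        using lin[OF True p] by (simp add: x(2) True p linear_scale)
      also have "\<dots> = (x ?y \<bullet> cross3 (v ?y) (w ?y)) * e1 f p
          + (u ?y \<bullet> cross3 (x ?y) (w ?y)) * e2 f p + (u ?y \<bullet> cross3 (v ?y) (x ?y)) * e3 f p"
        unfolding cramer using lin[OF True p]
        by (simp add: u(2) v(2) w(2) True p linear_add linear_scale)
      finally show ?thesis
        using d[of ?y] p by (simp add: field_simps)
    qed (simp add: vf_nonsmooth VF)
  qed
qed

text \<open>Independence at each point makes the coefficients unique there, so the local expansions
  agree on overlaps and glue.\<close>

lemma global_frame_expansion:
  assumes VF: "e1 \<in> vector_fields A" "e2 \<in> vector_fields A" "e3 \<in> vector_fields A"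
    "X \<in> vector_fields A"
    and indep: "\<And>p a b c. \<forall>f. a * e1 f p + b * e2 f p + c * e3 f p = 0 \<Longrightarrow> a = 0 \<and> b = 0 \<and> c = 0"
  shows "\<exists>a b c. smooth_fun A a \<and> smooth_fun A b \<and> smooth_fun A c \<and>
    X = fmult a e1 + fmult b e2 + fmult c e3"
proof -
  have loc: "\<exists>a b c. smooth_on (\<phi> ` U) a \<and> smooth_on (\<phi> ` U) b \<and> smooth_on (\<phi> ` U) c \<and>
      (\<forall>f p. p \<in> U \<longrightarrow> X f p = a (\<phi> p) * e1 f p + b (\<phi> p) * e2 f p + c (\<phi> p) * e3 f p)"
    if "(U, \<phi>) \<in> A" for U \<phi>
    by (rule local_frame_expansion[OF VF _ that]) (fact indep, blast)
  \<comment> \<open>The coefficients are first chosen point by point, with no regularity; comparison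
    with the local ones then shows that they are smooth in each chart.\<close>
  have "\<exists>a b c. \<forall>f. X f p = a * e1 f p + b * e2 f p + c * e3 f p" for p
    using loc chart_cover[of p] by metis
  then obtain a b c where X: "\<And>f p. X f p = a p * e1 f p + b p * e2 f p + c p * e3 f p"
    by metis
  have "smooth_fun A a \<and> smooth_fun A b \<and> smooth_fun A c"
    unfolding smooth_fun_def
  proof (intro conjI; safe)
    fix U \<phi> assume chart: "(U, \<phi>) \<in> A"
    obtain a' b' c' where *: "smooth_on (\<phi> ` U) a'" "smooth_on (\<phi> ` U) b'" "smooth_on (\<phi> ` U) c'"
      "\<And>f p. p \<in> U \<Longrightarrow> X f p = a' (\<phi> p) * e1 f p + b' (\<phi> p) * e2 f p + c' (\<phi> p) * e3 f p"
      using loc[OF chart] by blast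
    have "a' (\<phi> p) - a p = 0 \<and> b' (\<phi> p) - b p = 0 \<and> c' (\<phi> p) - c p = 0" if "p \<in> U" for p
    proof (rule indep, rule allI)
      show "(a' (\<phi> p) - a p) * e1 f p + (b' (\<phi> p) - b p) * e2 f p + (c' (\<phi> p) - c p) * e3 f p = 0"
        for f
        using X[of f p] *(4)[OF that, of f] by (simp add: algebra_simps)
    qed
    then have eq: "a' y = (a \<circ> inv_into U \<phi>) y" "b' y = (b \<circ> inv_into U \<phi>) y"
      "c' y = (c \<circ> inv_into U \<phi>) y" if "y \<in> \<phi> ` U" for y
      using that chart_inv[OF chart] by auto
    note cong = smooth_on_cong[OF open_chart_image[OF chart]]
    show "smooth_on (\<phi> ` U) (a \<circ> inv_into U \<phi>)" "smooth_on (\<phi> ` U) (b \<circ> inv_into U \<phi>)"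
      "smooth_on (\<phi> ` U) (c \<circ> inv_into U \<phi>)"
      using cong[OF *(1) eq(1)] cong[OF *(2) eq(2)] cong[OF *(3) eq(3)] by blast+
  qed
  then show ?thesis
    using X by (intro exI[of _ a] exI[of _ b] exI[of _ c]) (simp add: fun_eq_iff fmult_def)
qed

end

section \<open>Curvature in the left-invariant frame\<close>

text \<open>The group enters only through its frame, whose brackets and inner products have constant
  coefficients; the curvature computation is then algebra in these constants.\<close>

locale G6_frame = framed_manifold A e1 e2 e3
  for A :: "('a::{t2_space,second_countable_topology}, 'e::euclidean_space) chart set"
    and e1 e2 e3 :: "'a vfield" +
  fixes g :: "'a vfield \<Rightarrow> 'a vfield \<Rightarrow> 'a \<Rightarrow> real"
    and J :: "'a vfield \<Rightarrow> 'a vfield"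
    and nabla :: "'a vfield \<Rightarrow> 'a vfield \<Rightarrow> 'a vfield"
    and \<alpha> \<beta> \<gamma> \<delta> :: real
  assumes g_tensor: "tensor2 A g"
    and g_sym: "X \<in> vector_fields A \<Longrightarrow> Y \<in> vector_fields A \<Longrightarrow> g X Y = g Y X"
    and orthonormal: "g e1 e1 = (\<lambda>_. 1)" "g e2 e2 = (\<lambda>_. 1)" "g e3 e3 = (\<lambda>_. -1)"
      "g e1 e2 = (\<lambda>_. 0)" "g e1 e3 = (\<lambda>_. 0)" "g e2 e3 = (\<lambda>_. 0)"
    and brackets: "lie_bracket e1 e2 = \<alpha> *\<^sub>R e2 + \<beta> *\<^sub>R e3"
      "lie_bracket e1 e3 = \<gamma> *\<^sub>R e2 + \<delta> *\<^sub>R e3"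
      "lie_bracket e2 e3 = 0"
    and J_tensor: "tensor11 A J"
    and J_frame: "J e1 = e1" "J e2 = e2" "J e3 = - e3"
    and LC: "levi_civita A g nabla"
begin

section \<open>The Levi-Civita connection in the frame\<close>

lemma nabla_affine: "affine_connection A nabla"
  using LC unfolding levi_civita_def by blast

lemmas g_simps = tensor2_simps[OF g_tensor]
lemmas J_simps = tensor11_simps[OF J_tensor] J_frame
lemmas nabla_simps = affine_connection_simps[OF nabla_affine]

lemma orthonormal_swapped:
  "g e2 e1 = (\<lambda>_. 0)" "g e3 e1 = (\<lambda>_. 0)" "g e3 e2 = (\<lambda>_. 0)"
  using g_sym[of e2 e1] g_sym[of e3 e1] g_sym[of e3 e2] orthonormal by simp_all

lemma brackets_swapped:
  "lie_bracket e2 e1 = - (\<alpha> *\<^sub>R e2 + \<beta> *\<^sub>R e3)"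
  "lie_bracket e3 e1 = - (\<gamma> *\<^sub>R e2 + \<delta> *\<^sub>R e3)"
  "lie_bracket e3 e2 = 0"
  using lie_bracket_skew[of e2 e1] lie_bracket_skew[of e3 e1] lie_bracket_skew[of e3 e2] brackets
  by simp_all

lemmas frame_simps = orthonormal orthonormal_swapped brackets brackets_swapped

text \<open>Pairing with the frame reads off the coefficients; the third changes sign because
  \<open>e3\<close> is timelike.\<close>

lemma orthonormal_expansion:
  assumes "X \<in> vector_fields A" "\<And>p. g X e1 p = a" "\<And>p. g X e2 p = b" "\<And>p. g X e3 p = - c"
  shows "X = a *\<^sub>R e1 + b *\<^sub>R e2 + c *\<^sub>R e3"
proof -
  obtain a' b' c' where *: "smooth_fun A a'" "smooth_fun A b'" "smooth_fun A c'"
    and X: "X = fmult a' e1 + fmult b' e2 + fmult c' e3"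
    by (rule frame_expansionE[OF assms(1)])
  have "a' p = a" "b' p = b" "c' p = c" for p
    using assms(2-4)[of p] * by (simp_all add: X g_simps frame_simps)
  then have "a' = (\<lambda>_. a)" "b' = (\<lambda>_. b)" "c' = (\<lambda>_. c)" by auto
  then show ?thesis by (simp add: X scaleR_eq_fmult)
qed

text \<open>The derivative terms of the general Koszul formula are absent because \<open>g\<close>
  is constant on pairs of frame fields.\<close>

lemma koszul:
  assumes "X \<in> {e1, e2, e3}" "Y \<in> {e1, e2, e3}" "Z \<in> {e1, e2, e3}"
  shows "2 * g (nabla X Y) Z p =
    g (lie_bracket X Y) Z p - g (lie_bracket Y Z) X p + g (lie_bracket Z X) Y p"
proof -
  have const: "\<exists>c. g X Y = (\<lambda>_. c)" if "X \<in> {e1, e2, e3}" "Y \<in> {e1, e2, e3}" for X Y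
    using that orthonormal orthonormal_swapped by blast
  have VF: "X \<in> vector_fields A" if "X \<in> {e1, e2, e3}" for X
    using that by auto
  have metric: "g (nabla X Y) Z p + g Y (nabla X Z) p = 0"
    if fr: "X \<in> {e1, e2, e3}" "Y \<in> {e1, e2, e3}" "Z \<in> {e1, e2, e3}" for X Y Z
  proof -
    have "X (g Y Z) = g (nabla X Y) Z + g Y (nabla X Z)"
      using LC VF[OF fr(1)] VF[OF fr(2)] VF[OF fr(3)] unfolding levi_civita_def by blast
    moreover have "X (g Y Z) = 0"
      using const[OF fr(2,3)] vf_const[OF VF[OF fr(1)]] by auto
    ultimately show ?thesis by (simp add: fun_eq_iff)
  qed
  have torsion: "g (lie_bracket X Y) Z p = g (nabla X Y) Z p - g (nabla Y X) Z p"
    if fr: "X \<in> {e1, e2, e3}" "Y \<in> {e1, e2, e3}" "Z \<in> {e1, e2, e3}" for X Y Z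
  proof -
    have "lie_bracket X Y = nabla X Y - nabla Y X"
      using LC VF[OF fr(1)] VF[OF fr(2)] unfolding levi_civita_def by metis
    then show ?thesis
      using VF[OF fr(1)] VF[OF fr(2)] VF[OF fr(3)] by (simp add: g_simps nabla_simps)
  qed
  have sym: "g X (nabla Y Z) p = g (nabla Y Z) X p"
    if fr: "X \<in> {e1, e2, e3}" "Y \<in> {e1, e2, e3}" "Z \<in> {e1, e2, e3}" for X Y Z
    using g_sym[of X "nabla Y Z"] VF[OF fr(1)] VF[OF fr(2)] VF[OF fr(3)] by (simp add: nabla_simps)
  \<comment> \<open>Compatibility with the metric and vanishing torsion, each for the three cyclic
    orders of \<open>X\<close>, \<open>Y\<close>, \<open>Z\<close>, form a linear system that
    determines \<open>g (nabla X Y) Z p\<close>.\<close>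
  show ?thesis
    using metric[OF assms] metric[OF assms(2,3,1)] metric[OF assms(3,1,2)]
      torsion[OF assms] torsion[OF assms(2,3,1)] torsion[OF assms(3,1,2)]
      sym[OF assms(2,1,3)] sym[OF assms(3,2,1)] sym[OF assms(1,3,2)]
    by linarith
qed

lemma nabla_expansion:
  assumes "X \<in> {e1, e2, e3}" "Y \<in> {e1, e2, e3}"
    and "\<And>p. g (lie_bracket X Y) e1 p - g (lie_bracket Y e1) X p + g (lie_bracket e1 X) Y p = 2 * a"
    and "\<And>p. g (lie_bracket X Y) e2 p - g (lie_bracket Y e2) X p + g (lie_bracket e2 X) Y p = 2 * b"
    and "\<And>p. g (lie_bracket X Y) e3 p - g (lie_bracket Y e3) X p + g (lie_bracket e3 X) Y p = - 2 * c"
  shows "nabla X Y = a *\<^sub>R e1 + b *\<^sub>R e2 + c *\<^sub>R e3"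
proof (rule orthonormal_expansion)
  show "nabla X Y \<in> vector_fields A" using assms(1,2) by (auto simp: nabla_simps)
  show "g (nabla X Y) e1 p = a" "g (nabla X Y) e2 p = b" "g (nabla X Y) e3 p = - c" for p
    using assms(3-5)[of p] koszul[OF assms(1,2), of e1 p] koszul[OF assms(1,2), of e2 p]
      koszul[OF assms(1,2), of e3 p] by auto
qed

text \<open>Zero coefficients are written out so that each equation matches the conclusion of
  \<open>nabla_expansion\<close>.\<close>

lemma nabla_frame:
  "nabla e1 e1 = 0 *\<^sub>R e1 + 0 *\<^sub>R e2 + 0 *\<^sub>R e3"
  "nabla e1 e2 = 0 *\<^sub>R e1 + 0 *\<^sub>R e2 + ((\<beta> + \<gamma>) / 2) *\<^sub>R e3"
  "nabla e1 e3 = 0 *\<^sub>R e1 + ((\<beta> + \<gamma>) / 2) *\<^sub>R e2 + 0 *\<^sub>R e3"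
  "nabla e2 e1 = 0 *\<^sub>R e1 + (- \<alpha>) *\<^sub>R e2 + ((\<gamma> - \<beta>) / 2) *\<^sub>R e3"
  "nabla e2 e2 = \<alpha> *\<^sub>R e1 + 0 *\<^sub>R e2 + 0 *\<^sub>R e3"
  "nabla e2 e3 = ((\<gamma> - \<beta>) / 2) *\<^sub>R e1 + 0 *\<^sub>R e2 + 0 *\<^sub>R e3"
  "nabla e3 e1 = 0 *\<^sub>R e1 + ((\<beta> - \<gamma>) / 2) *\<^sub>R e2 + (- \<delta>) *\<^sub>R e3"
  "nabla e3 e2 = ((\<gamma> - \<beta>) / 2) *\<^sub>R e1 + 0 *\<^sub>R e2 + 0 *\<^sub>R e3"
  "nabla e3 e3 = (- \<delta>) *\<^sub>R e1 + 0 *\<^sub>R e2 + 0 *\<^sub>R e3"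
  by (rule nabla_expansion; (simp add: frame_simps g_simps)?; simp add: scaleR_fun_def)+

section \<open>The Kobayashi-Nomizu connection and its Ricci tensor in the frame\<close>

abbreviation "KN \<equiv> kobayashi_nomizu_connection nabla J"

lemmas KN_simps = affine_connection_simps[OF affine_connection_KN[OF nabla_affine J_tensor]]

text \<open>On frame fields from the same eigenbundle of \<open>J\<close>, the result is
  \<open>nabla X Y\<close> projected to that eigenbundle. On fields from opposite eigenbundles it is
  the bracket of \<open>X\<close> and \<open>Y\<close> projected to the eigenbundle of
  \<open>Y\<close>.\<close>

lemma KN_frame:
  "KN e1 e1 = 0" "KN e1 e2 = 0" "KN e1 e3 = \<delta> *\<^sub>R e3"
  "KN e2 e1 = - \<alpha> *\<^sub>R e2" "KN e2 e2 = \<alpha> *\<^sub>R e1" "KN e2 e3 = 0"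
  "KN e3 e1 = - \<gamma> *\<^sub>R e2" "KN e3 e2 = 0" "KN e3 e3 = 0"
  by (simp_all add: kobayashi_nomizu_connection_def canonical_connection_def cov_deriv11_def
      nabla_simps J_simps nabla_frame)
    (simp_all add: fun_eq_iff scaleR_fun_def field_simps)

abbreviation "Ric \<equiv> symmetrize (ricci g KN e1 e2 e3)"

lemma Ric_tensor: "tensor2 A Ric"
  by (intro tensor2_symmetrize tensor2_ricci affine_connection_KN nabla_affine J_tensor g_tensor)

lemmas Ric_simps = tensor2_simps[OF Ric_tensor]

lemma ricci_frame:
  "ricci g KN e1 e2 e3 e1 e1 = (\<lambda>_. - (\<alpha>\<^sup>2 + \<beta> * \<gamma>))"
  "ricci g KN e1 e2 e3 e1 e2 = 0" "ricci g KN e1 e2 e3 e1 e3 = 0"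
  "ricci g KN e1 e2 e3 e2 e1 = 0" "ricci g KN e1 e2 e3 e2 e2 = (\<lambda>_. - \<alpha>\<^sup>2)"
  "ricci g KN e1 e2 e3 e2 e3 = 0" "ricci g KN e1 e2 e3 e3 e1 = 0"
  "ricci g KN e1 e2 e3 e3 e2 = 0" "ricci g KN e1 e2 e3 e3 e3 = 0"
  by (simp_all add: ricci_def curvature_def KN_simps KN_frame g_simps frame_simps)
    (simp_all add: fun_eq_iff scaleR_fun_def power2_eq_square algebra_simps)

text \<open>The Ricci matrix is already diagonal, so symmetrization leaves its entries
  unchanged.\<close>

lemma Ric_frame:
  "Ric e1 e1 = (\<lambda>_. - (\<alpha>\<^sup>2 + \<beta> * \<gamma>))" "Ric e2 e2 = (\<lambda>_. - \<alpha>\<^sup>2)" "Ric e3 e3 = 0"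
  "Ric e1 e2 = 0" "Ric e1 e3 = 0" "Ric e2 e3 = 0" "Ric e2 e1 = 0" "Ric e3 e1 = 0" "Ric e3 e2 = 0"
  by (simp_all add: symmetrize_def ricci_frame) (simp_all add: fun_eq_iff scaleR_fun_def)

text \<open>Every entry of the Lie derivative on the frame carries the factor
  \<open>\<alpha>\<^sup>2\<close>, whence the alternative \<alpha> = 0.\<close>

lemma collineation_iff:
  fixes l1 l2 l3
  defines "\<xi> \<equiv> l1 *\<^sub>R e1 + l2 *\<^sub>R e2 + l3 *\<^sub>R e3"
  shows "(\<forall>X\<in>vector_fields A. \<forall>Y\<in>vector_fields A. lie_derivative2 \<xi> Ric X Y = 0) \<longleftrightarrow>
    \<alpha> = 0 \<or> l1 = 0 \<and> \<alpha> * l2 + \<gamma> * l3 = 0"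
proof -
  have \<xi>: "\<xi> \<in> vector_fields A" by (simp add: \<xi>_def)
  let ?L = "lie_derivative2 \<xi> Ric"
  note simps = lie_derivative2_def Ric_frame vf_const[OF \<xi>] vf_zero[OF \<xi>]
  have br: "lie_bracket \<xi> e1 = - ((l2 * \<alpha> + l3 * \<gamma>) *\<^sub>R e2) - (l2 * \<beta> + l3 * \<delta>) *\<^sub>R e3"
    "lie_bracket \<xi> e2 = l1 *\<^sub>R (\<alpha> *\<^sub>R e2 + \<beta> *\<^sub>R e3)"
    "lie_bracket \<xi> e3 = l1 *\<^sub>R (\<gamma> *\<^sub>R e2 + \<delta> *\<^sub>R e3)"
    unfolding \<xi>_def by (simp_all add: frame_simps) (simp_all add: fun_eq_iff scaleR_fun_def algebra_simps)
  \<comment> \<open>The Ricci entries are constant, so only bracket terms remain. As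
    \<open>e3\<close> lies in the kernel of \<open>Ric\<close>, the \<open>e3\<close>-components of
    the brackets, and with them \<beta> and \<delta>, drop out.\<close>
  have L: "?L e1 e1 = 0" "?L e1 e2 = (\<lambda>_. - \<alpha>\<^sup>2 * (\<alpha> * l2 + \<gamma> * l3))" "?L e1 e3 = 0"
    "?L e2 e1 = (\<lambda>_. - \<alpha>\<^sup>2 * (\<alpha> * l2 + \<gamma> * l3))" "?L e2 e2 = (\<lambda>_. 2 * l1 * \<alpha> ^ 3)"
    "?L e2 e3 = (\<lambda>_. l1 * \<gamma> * \<alpha>\<^sup>2)" "?L e3 e1 = 0" "?L e3 e2 = (\<lambda>_. l1 * \<gamma> * \<alpha>\<^sup>2)"
    "?L e3 e3 = 0"
    by (simp_all add: simps br Ric_simps)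
      (simp_all add: fun_eq_iff scaleR_fun_def power2_eq_square power3_eq_cube algebra_simps)
  show ?thesis
  proof
    assume "\<forall>X\<in>vector_fields A. \<forall>Y\<in>vector_fields A. ?L X Y = 0"
    \<comment> \<open>These two entries carry all the conditions; the entry at \<open>e2\<close>,
      \<open>e3\<close> vanishes as soon as \<alpha> or \<open>l1\<close> does.\<close>
    then have "?L e1 e2 = 0" "?L e2 e2 = 0" by auto
    then show "\<alpha> = 0 \<or> l1 = 0 \<and> \<alpha> * l2 + \<gamma> * l3 = 0"
      unfolding L by (auto simp: fun_eq_iff)
  next
    assume *: "\<alpha> = 0 \<or> l1 = 0 \<and> \<alpha> * l2 + \<gamma> * l3 = 0"
    have "?L e1 e2 = 0" "?L e2 e1 = 0" "?L e2 e2 = 0" "?L e2 e3 = 0" "?L e3 e2 = 0"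
      using * unfolding L by (auto simp: fun_eq_iff)
    then have "?L X Y = 0" if "X \<in> {e1, e2, e3}" "Y \<in> {e1, e2, e3}" for X Y
      using that L(1,3,7,9) by (elim insertE emptyE) simp_all
    then show "\<forall>X\<in>vector_fields A. \<forall>Y\<in>vector_fields A. ?L X Y = 0"
      using tensor2_eq_0[OF tensor2_lie_derivative2[OF Ric_tensor \<xi>]] by blast
  qed
qed

end

section \<open>The collineations of the Lie group\<close>

lemma span_triple:
  "span {u, v, w} = {a *\<^sub>R u + b *\<^sub>R v + c *\<^sub>R w | a b c. True}" for u v w :: "'a::real_vector"
proof
  show "span {u, v, w} \<subseteq> {a *\<^sub>R u + b *\<^sub>R v + c *\<^sub>R w | a b c. True}"
  proof
    fix x assume "x \<in> span {u, v, w}"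
    then obtain a b c where "x - a *\<^sub>R u - b *\<^sub>R v - c *\<^sub>R w = 0"
      by (auto simp: span_insert)
    then have "x = a *\<^sub>R u + b *\<^sub>R v + c *\<^sub>R w" by (simp add: algebra_simps)
    then show "x \<in> {a *\<^sub>R u + b *\<^sub>R v + c *\<^sub>R w | a b c. True}" by blast
  qed
qed (auto intro: span_add span_scale span_base)

theorem theorem4p13:
  fixes A :: "('a::{t2_space,second_countable_topology}, real^3) chart set"
    and mul :: "'a \<Rightarrow> 'a \<Rightarrow> 'a" and idt :: 'a and iv :: "'a \<Rightarrow> 'a"
    and g :: "'a vfield \<Rightarrow> 'a vfield \<Rightarrow> 'a \<Rightarrow> real"
    and J :: "'a vfield \<Rightarrow> 'a vfield"
    and nabla :: "'a vfield \<Rightarrow> 'a vfield \<Rightarrow> 'a vfield"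
    and e1 e2 e3 :: "'a vfield"
    and \<alpha> \<beta> \<gamma> \<delta> :: real
    and V :: "'a vfield set"
  assumes params: "\<alpha> + \<delta> \<noteq> 0" "\<alpha> * \<gamma> - \<beta> * \<delta> = 0"
    and G6: "lie_group A mul idt iv" "connected (UNIV :: 'a set)"
    and metric: "lorentz_metric3 A g" "left_inv_metric A mul iv g"
    and basis: "independent {e1, e2, e3}" "span {e1, e2, e3} = left_inv_fields A mul iv"
    and pseudo_orthonormal: "g e1 e1 = (\<lambda>_. 1)" "g e2 e2 = (\<lambda>_. 1)" "g e3 e3 = (\<lambda>_. -1)"
      "g e1 e2 = (\<lambda>_. 0)" "g e1 e3 = (\<lambda>_. 0)" "g e2 e3 = (\<lambda>_. 0)"
    and brackets: "lie_bracket e1 e2 = \<alpha> *\<^sub>R e2 + \<beta> *\<^sub>R e3"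
      "lie_bracket e1 e3 = \<gamma> *\<^sub>R e2 + \<delta> *\<^sub>R e3"
      "lie_bracket e2 e3 = 0"
    and product_structure: "left_inv_product_structure A mul iv J"
      "J e1 = e1" "J e2 = e2" "J e3 = - e3"
    and LC: "levi_civita A g nabla"
    and V: "V = ricci_collineations_KN A mul iv g J nabla e1 e2 e3"
  shows "((\<exists>\<xi>\<in>V. \<xi> \<noteq> 0) \<longleftrightarrow> (\<alpha> = 0 \<and> \<beta> = 0 \<and> \<delta> \<noteq> 0) \<or> \<alpha> \<noteq> 0)
    \<and> (\<alpha> = 0 \<and> \<beta> = 0 \<and> \<delta> \<noteq> 0 \<longrightarrow> V = span {e1, e2, e3})
    \<and> (\<alpha> \<noteq> 0 \<longrightarrow> V = span {(- (\<gamma> / \<alpha>)) *\<^sub>R e2 + e3}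
         \<and> (\<forall>l1 l2 l3. l1 *\<^sub>R e1 + l2 *\<^sub>R e2 + l3 *\<^sub>R e3 \<in> V \<longrightarrow> l2 = - (\<gamma> / \<alpha>) * l3))"
proof -
  have group: "group mul idt iv" and "smooth_atlas A"
    using G6(1) unfolding lie_group_def by auto
  then interpret manifold3 A by unfold_locales
  have sym_g: "sym_tensor2 A g" using metric(1) unfolding lorentz_metric3_def by blast
  then have g: "tensor2 A g" by (rule sym_tensor2_imp_tensor2[OF smooth_manifold_axioms])
  have g_sym: "g X Y = g Y X" if "X \<in> vector_fields A" "Y \<in> vector_fields A" for X Y
    using sym_g that unfolding sym_tensor2_def by blast
  have "e1 \<in> left_inv_fields A mul iv" "e2 \<in> left_inv_fields A mul iv" "e3 \<in> left_inv_fields A mul iv"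
    unfolding basis(2)[symmetric] by (simp_all add: span_base)
  then have VF: "e1 \<in> vector_fields A" "e2 \<in> vector_fields A" "e3 \<in> vector_fields A"
    unfolding left_inv_fields_def by auto
  have comb_left_inv: "a *\<^sub>R e1 + b *\<^sub>R e2 + c *\<^sub>R e3 \<in> left_inv_fields A mul iv" for a b c
    unfolding basis(2)[symmetric] span_triple by blast
  \<comment> \<open>Pairing with the frame gives independence of the triple, including the
    distinctness of its members, which the set \<open>{e1, e2, e3}\<close> does not record.\<close>
  have coeffs: "g (a *\<^sub>R e1 + b *\<^sub>R e2 + c *\<^sub>R e3) e1 p = a"
    "g (a *\<^sub>R e1 + b *\<^sub>R e2 + c *\<^sub>R e3) e2 p = b"
    "g (a *\<^sub>R e1 + b *\<^sub>R e2 + c *\<^sub>R e3) e3 p = - c" for a b c p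
    using g_sym[OF VF(2,1)] g_sym[OF VF(3,1)] g_sym[OF VF(3,2)]
    by (simp_all add: tensor2_simps[OF g] VF pseudo_orthonormal) (simp_all add: scaleR_fun_def)
  have indep: "a = 0 \<and> b = 0 \<and> c = 0" if "a *\<^sub>R e1 + b *\<^sub>R e2 + c *\<^sub>R e3 = 0" for a b c
    using coeffs[of a b c, unfolded that] VF by (simp add: tensor2_zero[OF g])
  \<comment> \<open>A constant combination is left-invariant, so its vanishing at one point forces
    it to vanish everywhere; this is what yields a frame at every point.\<close>
  have pointwise_indep: "a = 0 \<and> b = 0 \<and> c = 0"
    if "\<forall>f. a * e1 f p + b * e2 f p + c * e3 f p = 0" for p a b c
  proof (rule indep, rule left_inv_field_eq_0[OF group comb_left_inv])
    show "(a *\<^sub>R e1 + b *\<^sub>R e2 + c *\<^sub>R e3) f p = 0" for f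
      using that by (simp add: scaleR_fun_def)
  qed
  interpret G6_frame A e1 e2 e3 g J nabla \<alpha> \<beta> \<gamma> \<delta>
  proof unfold_locales
    show "\<exists>a b c. smooth_fun A a \<and> smooth_fun A b \<and> smooth_fun A c \<and>
        X = fmult a e1 + fmult b e2 + fmult c e3" if "X \<in> vector_fields A" for X
      using global_frame_expansion[OF VF that pointwise_indep] .
  qed (use product_structure(1) in \<open>simp_all add: VF g g_sym pseudo_orthonormal brackets
      product_structure(2-4) LC left_inv_product_structure_def\<close>)
  have V_iff: "a *\<^sub>R e1 + b *\<^sub>R e2 + c *\<^sub>R e3 \<in> V \<longleftrightarrow> \<alpha> = 0 \<or> a = 0 \<and> \<alpha> * b + \<gamma> * c = 0" for a b c
    using collineation_iff[of a b c] comb_left_inv[of a b c]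
    by (simp add: V ricci_collineations_KN_def left_inv_collineations_def)
  have V_subset: "V \<subseteq> span {e1, e2, e3}"
    unfolding basis(2) V ricci_collineations_KN_def left_inv_collineations_def by auto
  let ?v = "(- (\<gamma> / \<alpha>)) *\<^sub>R e2 + e3"
  show ?thesis
  proof (cases "\<alpha> = 0")
    case True
    \<comment> \<open>With \<alpha> = 0 the constraints read \<delta> \<noteq> 0 and \<beta>\<delta>
      = 0, so this branch is exactly case (1). There \<open>Ric\<close> vanishes on the frame and
      every left-invariant field is a collineation.\<close>
    then have "\<delta> \<noteq> 0" "\<beta> = 0" using params by auto
    have "V = span {e1, e2, e3}"
      using V_subset V_iff True unfolding span_triple by blast
    moreover have "e1 \<in> span {e1, e2, e3}" by (simp add: span_base)
    moreover have "e1 \<noteq> 0" using indep[of 1 0 0] by auto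
    ultimately show ?thesis using True \<open>\<delta> \<noteq> 0\<close> \<open>\<beta> = 0\<close> by blast
  next
    case False
    \<comment> \<open>For \<alpha> \<noteq> 0 the remaining linear equation is solved for the
      \<open>e2\<close>-coefficient, which leaves the \<open>e3\<close>-coefficient as the only
      parameter.\<close>
    have coeff: "a = 0 \<and> b = - (\<gamma> / \<alpha>) * c" if "a *\<^sub>R e1 + b *\<^sub>R e2 + c *\<^sub>R e3 \<in> V" for a b c
      using V_iff[of a b c] that False by (simp add: field_simps)
    have "V = span {?v}"
    proof
      show "V \<subseteq> span {?v}"
      proof
        fix \<xi> assume "\<xi> \<in> V"
        then obtain a b c where \<xi>: "\<xi> = a *\<^sub>R e1 + b *\<^sub>R e2 + c *\<^sub>R e3"
          using V_subset unfolding span_triple by blast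
        then have "\<xi> = c *\<^sub>R ?v"
          using coeff[of a b c] \<open>\<xi> \<in> V\<close> by (simp add: algebra_simps)
        then show "\<xi> \<in> span {?v}" unfolding span_singleton by blast
      qed
      have "c *\<^sub>R ?v \<in> V" for c
        using V_iff[of 0 "- (\<gamma> / \<alpha>) * c" c] False
        by (simp add: algebra_simps)
      then show "span {?v} \<subseteq> V" unfolding span_singleton by blast
    qed
    moreover have "?v \<in> span {?v}" by (simp add: span_base)
    moreover have "?v \<noteq> 0" using indep[of 0 "- (\<gamma> / \<alpha>)" 1] by auto
    ultimately show ?thesis using False coeff by blast
  qed
qed

end
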